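(* Let $G=\Sigma_3$ be the symmetric group on three letters, let $S=\Sigma_3\sqcup\ast\sqcup\ast$ be the disjoint union of the regular $G$-set ($\Sigma_3$ acting on itself by left multiplication) and two one-point $G$-sets, and let $S'=\Sigma_3/\langle(12)\rangle\sqcup\Sigma_3/\langle(12)\rangle\sqcup\Sigma_3/\langle(123)\rangle$. Let $\rho$ and $\rho'$ be the 8-dimensional 2-representations of $\Sigma_3$ in $2Vect_{\mathbb{C}}$ given by $S$ and $S'$, respectively, each with the trivial cocycle. Then $\rho$ and $\rho'$ are not equivalent, but their 2-characters coincide: $\chi_\rho(g,h)=\chi_{\rho'}(g,h)$ for all commuting pairs $g,h\in\Sigma_3$. In particular, the map from equivalence classes of 2-representations to 2-characters is not injective.
   Context: **2-vector spaces.** For a field $k$, the 2-category $2Vect_k$ has objects $[n]$, $n\in\{0,1,2,\dots\}$; 1-morphisms are 2-matrices, i.e. matrices whose entries are $k$-vector spaces (an endomorphism of $[n]$ is an $n\times n$ 2-matrix), composed by matrix multiplication using $\oplus$ and $\otimes$ (with the usual canonical isomorphisms treated as identities); 2-morphisms $A\Rightarrow B$ between 2-matrices of the same size are matrices of linear maps $A_{ij}\to B_{ij}$. The identity $\mathbf 1_{[n]}$ has $k$ on the diagonal and $0$ elsewhere. Write $\cdot$ or juxtaposition for the (entrywise) composition of 2-morphisms and $\circ$ for composition of 1-morphisms and whiskering. **2-representations.** A 2-representation of $G$ in $2Vect_k$ consists of an object $[n]$ ($n$ is the dimension), 1-morphisms $\rho_g:[n]\to[n]$ for $g\in G$, a 2-isomorphism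 $\phi_1:\rho_1\Rightarrow\mathbf 1_{[n]}$, and 2-isomorphisms $\phi_{g,h}:\rho_g\circ\rho_h\Rightarrow\rho_{gh}$ for $g,h\in G$, such that $\phi_{gh,l}(\phi_{g,h}\circ\rho_l)=\phi_{g,hl}(\rho_g\circ\phi_{h,l})$ for all $g,h,l\in G$, and $\phi_{1,g}=\phi_1\circ\rho_g$, $\phi_{g,1}=\rho_g\circ\phi_1$ for all $g\in G$. **2-representation given by a $G$-set with trivial cocycle.** For a finite $G$-set $S$ with $n$ elements (ordered), it is the 2-representation on $[n]$ with $\rho_g$ the permutation 2-matrix having entry $\mathbb{C}$ in position $(gs,s)$ for each $s\in S$ and $0$ elsewhere, and with all $\phi_{g,h}$ and $\phi_1$ identities. **Equivalence.** Two 2-representations $(\rho,\phi)$ on $[n]$ and $(\rho',\phi')$ on $[n']$ are equivalent if there are a 1-morphism $f:[n]\to[n']$ (written as a 2-matrix so that the composites $\rho'_g\circ f$ and $f\circ\rho_g$ are matrix products) that is weakly invertible (invertible up to 2-isomorphism) and 2-isomorphisms $\psi(g):\rho'_g\circ f\Rightarrow f\circ\rho_g$, $g\in G$, such that $\psi(gh)\cdot(\phi'_{g,h}\circ\mathbf 1_f)=(\mathbf 1_f\circ\phi_{g,h})\cdot(\psi(g)\circ\mathbf 1_{\rho_h})\cdot(\mathbf 1_{\rho'_g}\circ\psi(h))$ for all $g,h\in G$, and $\phi'_1\circ\mathbf 1_f=(\mathbf 1_f\circ\phi_1)\cdot\psi(1)$. **2-character.** The categorical trace of a 1-endomorphism $F:[n]\to[n]$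 is the vector space $\mathbb{T}r(F)=2Hom(\mathbf 1_{[n]},F)$ $(=\bigoplus_i F_{ii})$. For $g,h\in G$ the linear map $\psi_g(h):\mathbb{T}r(\rho_h)\to\mathbb{T}r(\rho_{ghg^{-1}})$ sends $\varphi:\mathbf 1_{[n]}\Rightarrow\rho_h$ to $$\phi_{g,h,g^{-1}}\cdot(\rho_g\circ\varphi\circ\rho_{g^{-1}})\cdot\phi_{g,g^{-1}}^{-1}\cdot\phi_1^{-1},\qquad \phi_{g,h,g^{-1}}=\phi_{g,hg^{-1}}(\rho_g\circ\phi_{h,g^{-1}}):\rho_g\circ\rho_h\circ\rho_{g^{-1}}\Rightarrow\rho_{ghg^{-1}}.$$ If $gh=hg$, this is an endomorphism of $\mathbb{T}r(\rho_h)$, and the 2-character is $\chi_\rho(g,h)=\operatorname{trace}\bigl(\psi_g(h):\mathbb{T}r(\rho_h)\to\mathbb{T}r(\rho_h)\bigr)$. *)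

theory Defs
  imports
    Complex_Main
    "HOL-Library.Function_Algebras"
    "HOL-Algebra.Sym_Groups"
    "HOL-Algebra.Left_Coset"
    "HOL-Algebra.Group_Action"
begin

section \<open>Vector spaces and linear maps\<close>

text \<open>
  A \<open>'k\<close>-vector space is represented as a linear subspace of a function space \<open>'i \<Rightarrow> 'k\<close>. Every
  vector space is isomorphic to one of this form, and direct sums and tensor products have concrete
  models of the same form (over another index type).
\<close>

definition fscale :: "'k::field \<Rightarrow> ('i \<Rightarrow> 'k) \<Rightarrow> 'i \<Rightarrow> 'k"
  where "fscale c v = (\<lambda>x. c * v x)"

interpretation fun_space: vector_space fscale
  by unfold_locales (auto simp: fscale_def fun_eq_iff algebra_simps)

definition linear_map ::
    "('i \<Rightarrow> 'k::field) set \<Rightarrow> ('j \<Rightarrow> 'k) set \<Rightarrow> (('i \<Rightarrow> 'k) \<Rightarrow> ('j \<Rightarrow> 'k)) \<Rightarrow> bool"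
  where "linear_map V W T \<longleftrightarrow>
    (\<forall>v\<in>V. T v \<in> W) \<and>
    (\<forall>v\<in>V. \<forall>w\<in>V. T (v + w) = T v + T w) \<and>
    (\<forall>c. \<forall>v\<in>V. T (fscale c v) = fscale c (T v))"

text \<open>The trace of an endomorphism \<open>T\<close> of a finite-dimensional subspace \<open>V\<close>, as the sum of the
  diagonal coefficients with respect to some basis of \<open>V\<close>.\<close>

definition (in vector_space) trace_on :: "'b set \<Rightarrow> ('b \<Rightarrow> 'b) \<Rightarrow> 'a"
  where "trace_on V T =
    (let B = (SOME B. finite B \<and> independent B \<and> span B = V)
     in \<Sum>b\<in>B. representation B (T b) b)"


section \<open>2-matrices and their 2-morphisms\<close>

text \<open>A 1-morphism \<open>[src A] \<rightarrow> [tgt A]\<close> has \<open>tgt A\<close> rows and \<open>src A\<close> columns; the values of \<open>ent A\<close>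
  outside that range are irrelevant.\<close>

record ('i, 'k) mat2 =
  tgt :: nat
  src :: nat
  ent :: "nat \<Rightarrow> nat \<Rightarrow> ('i \<Rightarrow> 'k) set"

definition hom1 :: "nat \<Rightarrow> nat \<Rightarrow> ('i, 'k::field) mat2 set"
  where "hom1 n m = {A. src A = n \<and> tgt A = m \<and>
    (\<forall>i<m. \<forall>j<n. fun_space.subspace (ent A i j))}"

type_synonym ('i, 'j, 'k) mor2 = "nat \<Rightarrow> nat \<Rightarrow> ('i \<Rightarrow> 'k) \<Rightarrow> ('j \<Rightarrow> 'k)"

text \<open>2-morphisms are normalised to be zero outside their domain, so that equality of 2-morphisms is
  equality in HOL and \<open>2Hom(A, B)\<close> is a linear subspace of the type \<open>mor2\<close>.\<close>

definition restr2 :: "('i, 'k::field) mat2 \<Rightarrow> ('i, 'j, 'k) mor2 \<Rightarrow> ('i, 'j, 'k) mor2"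
  where "restr2 A \<alpha> =
    (\<lambda>i j v. if i < tgt A \<and> j < src A \<and> v \<in> ent A i j then \<alpha> i j v else 0)"

definition hom2 :: "('i, 'k::field) mat2 \<Rightarrow> ('j, 'k) mat2 \<Rightarrow> ('i, 'j, 'k) mor2 set"
  where "hom2 A B = {\<alpha>. src A = src B \<and> tgt A = tgt B \<and> restr2 A \<alpha> = \<alpha> \<and>
    (\<forall>i<tgt A. \<forall>j<src A. linear_map (ent A i j) (ent B i j) (\<alpha> i j))}"

definition mscale :: "'k::field \<Rightarrow> ('i, 'j, 'k) mor2 \<Rightarrow> ('i, 'j, 'k) mor2"
  where "mscale c \<alpha> = (\<lambda>i j v. fscale c (\<alpha> i j v))"

interpretation mor_space: vector_space mscale
  by unfold_locales (auto simp: mscale_def fscale_def fun_eq_iff algebra_simps)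

definition id2 :: "('i, 'k::field) mat2 \<Rightarrow> ('i, 'i, 'k) mor2"
  where "id2 A = restr2 A (\<lambda>i j v. v)"

definition vcomp :: "('j, 'l, 'k) mor2 \<Rightarrow> ('i, 'j, 'k) mor2 \<Rightarrow> ('i, 'l, 'k) mor2"  (infixr "\<cdot>" 65)
  where "\<beta> \<cdot> \<alpha> = (\<lambda>i j v. \<beta> i j (\<alpha> i j v))"

definition iso2 :: "('i, 'k::field) mat2 \<Rightarrow> ('j, 'k) mat2 \<Rightarrow> ('i, 'j, 'k) mor2 \<Rightarrow> bool"
  where "iso2 A B \<alpha> \<longleftrightarrow> \<alpha> \<in> hom2 A B \<and> (\<exists>\<beta>\<in>hom2 B A. \<beta> \<cdot> \<alpha> = id2 A \<and> \<alpha> \<cdot> \<beta> = id2 B)"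

definition inv2 :: "('i, 'k::field) mat2 \<Rightarrow> ('j, 'k) mat2 \<Rightarrow> ('i, 'j, 'k) mor2 \<Rightarrow> ('j, 'i, 'k) mor2"
  where "inv2 A B \<alpha> = restr2 B (\<lambda>i j. inv_into (ent A i j) (\<alpha> i j))"

text \<open>The ground field, as a one-dimensional space, is \<open>unit \<Rightarrow> 'k\<close>.\<close>

definition one1 :: "nat \<Rightarrow> (unit, 'k::field) mat2"
  where "one1 n = \<lparr>tgt = n, src = n, ent = (\<lambda>i j. if i = j then UNIV else {0})\<rparr>"

text \<open>
  The \<open>(i, k)\<close> entry of \<open>A \<bullet> B\<close> is \<open>\<Oplus>\<^sub>j A\<^sub>i\<^sub>j \<otimes> B\<^sub>j\<^sub>k\<close>. The tensor product of \<open>V \<subseteq> 'i \<Rightarrow> 'k\<close> and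
  \<open>W \<subseteq> 'j \<Rightarrow> 'k\<close> is the span, in \<open>'i \<times> 'j \<Rightarrow> 'k\<close>, of the functions \<open>\<lambda>(x, y). v x * w y\<close>; the middle
  component of \<open>'i \<times> nat \<times> 'j\<close> indexes the summands of the direct sum.
\<close>

definition pure :: "nat \<Rightarrow> ('i \<Rightarrow> 'k::field) \<Rightarrow> ('j \<Rightarrow> 'k) \<Rightarrow> ('i \<times> nat \<times> 'j \<Rightarrow> 'k)"
  where "pure j v w = (\<lambda>(x, l, y). if l = j then v x * w y else 0)"

definition comp1 :: "('i, 'k::field) mat2 \<Rightarrow> ('j, 'k) mat2 \<Rightarrow> ('i \<times> nat \<times> 'j, 'k) mat2"
    (infixl "\<bullet>" 70)
  where "A \<bullet> B = \<lparr>tgt = tgt A, src = src B,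
    ent = (\<lambda>i k. fun_space.span
      {pure j v w | j v w. j < src A \<and> v \<in> ent A i j \<and> w \<in> ent B j k})\<rparr>"

text \<open>The horizontal composite of \<open>\<alpha> : A \<Rightarrow> A'\<close> and \<open>\<beta> : B \<Rightarrow> B'\<close>, with components
  \<open>\<Oplus>\<^sub>j \<alpha>\<^sub>i\<^sub>j \<otimes> \<beta>\<^sub>j\<^sub>k\<close>: on each summand, \<open>\<beta>\<close> is applied in the second tensor factor and then \<open>\<alpha>\<close> in
  the first one. See \<open>hcomp_pure\<close> and \<open>hcomp_hom2\<close> below.\<close>

definition hcomp :: "('i, 'k::field) mat2 \<Rightarrow> ('j, 'k) mat2 \<Rightarrow>
    ('i, 'i2, 'k) mor2 \<Rightarrow> ('j, 'j2, 'k) mor2 \<Rightarrow> ('i \<times> nat \<times> 'j, 'i2 \<times> nat \<times> 'j2, 'k) mor2"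
  where "hcomp A B \<alpha> \<beta> = restr2 (A \<bullet> B)
    (\<lambda>i k t (x, j, y). \<alpha> i j (\<lambda>x'. \<beta> j k (\<lambda>y'. t (x', j, y')) y) x)"

abbreviation lwhisk :: "('i, 'k::field) mat2 \<Rightarrow> ('j, 'k) mat2 \<Rightarrow> ('j, 'j2, 'k) mor2 \<Rightarrow>
    ('i \<times> nat \<times> 'j, 'i \<times> nat \<times> 'j2, 'k) mor2"
  where "lwhisk A B \<beta> \<equiv> hcomp A B (id2 A) \<beta>"

abbreviation rwhisk :: "('i, 'k::field) mat2 \<Rightarrow> ('j, 'k) mat2 \<Rightarrow> ('i, 'i2, 'k) mor2 \<Rightarrow>
    ('i \<times> nat \<times> 'j, 'i2 \<times> nat \<times> 'j, 'k) mor2"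
  where "rwhisk A B \<alpha> \<equiv> hcomp A B \<alpha> (id2 B)"

text \<open>The canonical 2-isomorphisms: \<open>assoc : (A \<bullet> B) \<bullet> C \<Rightarrow> A \<bullet> (B \<bullet> C)\<close>, \<open>lunit : 1 \<bullet> B \<Rightarrow> B\<close>,
  \<open>runit : A \<bullet> 1 \<Rightarrow> A\<close>, and the inverses of the first two.\<close>

definition assoc :: "('i, 'k::field) mat2 \<Rightarrow> ('j, 'k) mat2 \<Rightarrow> ('l, 'k) mat2 \<Rightarrow>
    (('i \<times> nat \<times> 'j) \<times> nat \<times> 'l, 'i \<times> nat \<times> ('j \<times> nat \<times> 'l), 'k) mor2"
  where "assoc A B C = restr2 ((A \<bullet> B) \<bullet> C) (\<lambda>_ _ t (x, j, (y, k, z)). t ((x, j, y), k, z))"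

definition assoc_inv :: "('i, 'k::field) mat2 \<Rightarrow> ('j, 'k) mat2 \<Rightarrow> ('l, 'k) mat2 \<Rightarrow>
    ('i \<times> nat \<times> ('j \<times> nat \<times> 'l), ('i \<times> nat \<times> 'j) \<times> nat \<times> 'l, 'k) mor2"
  where "assoc_inv A B C = restr2 (A \<bullet> (B \<bullet> C)) (\<lambda>_ _ t ((x, j, y), k, z). t (x, j, (y, k, z)))"

definition lunit :: "('i, 'k::field) mat2 \<Rightarrow> (unit \<times> nat \<times> 'i, 'i, 'k) mor2"
  where "lunit B = restr2 (one1 (tgt B) \<bullet> B) (\<lambda>i _ t y. t ((), i, y))"

definition lunit_inv :: "('i, 'k::field) mat2 \<Rightarrow> ('i, unit \<times> nat \<times> 'i, 'k) mor2"
  where "lunit_inv B = restr2 B (\<lambda>i _ v. pure i 1 v)"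

definition runit :: "('i, 'k::field) mat2 \<Rightarrow> ('i \<times> nat \<times> unit, 'i, 'k) mor2"
  where "runit A = restr2 (A \<bullet> one1 (src A)) (\<lambda>_ k t x. t (x, k, ()))"

lemma hom2_zero:
  assumes "\<alpha> \<in> hom2 A B"
  shows "\<alpha> i j 0 = 0"
proof (cases "i < tgt A \<and> j < src A \<and> 0 \<in> ent A i j")
  case True
  then have "\<alpha> i j (fscale 0 0) = fscale 0 (\<alpha> i j 0)"
    using assms unfolding hom2_def linear_map_def by blast
  then show ?thesis by simp
next
  case False
  have "\<alpha> i j 0 = restr2 A \<alpha> i j 0"
    using assms by (simp add: hom2_def)
  then show ?thesis using False by (auto simp: restr2_def)
qed

lemma hcomp_pure:
  assumes "i < tgt A" "j < src A" "k < src B" "src A = tgt B"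
    and \<alpha>: "\<alpha> \<in> hom2 A A'" and \<beta>: "\<beta> \<in> hom2 B B'" and v: "v \<in> ent A i j" and w: "w \<in> ent B j k"
  shows "hcomp A B \<alpha> \<beta> i k (pure j v w) = pure j (\<alpha> i j v) (\<beta> j k w)"
proof -
  have 1: "\<beta> j k (fscale c w) = fscale c (\<beta> j k w)" for c
    using assms unfolding hom2_def linear_map_def by simp
  have 2: "\<alpha> i j (fscale c v) = fscale c (\<alpha> i j v)" for c
    using assms unfolding hom2_def linear_map_def by simp
  have mem: "pure j v w \<in> ent (A \<bullet> B) i k"
    unfolding comp1_def using assms by (auto intro!: fun_space.span_base)
  have "\<alpha> i l (\<lambda>x'. \<beta> l k (\<lambda>y'. pure j v w (x', l, y')) y) x =
      pure j (\<alpha> i j v) (\<beta> j k w) (x, l, y)" for x l y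
  proof (cases "l = j")
    case True
    have "\<beta> j k (\<lambda>y'. v x' * w y') y = v x' * \<beta> j k w y" for x'
      using 1[of "v x'"] by (simp add: fscale_def)
    moreover have "\<alpha> i j (\<lambda>x'. v x' * \<beta> j k w y) x = \<alpha> i j v x * \<beta> j k w y"
      using 2[of "\<beta> j k w y"] by (simp add: fscale_def mult.commute)
    ultimately show ?thesis using True by (simp add: pure_def)
  next
    case False
    have "(\<lambda>y'. pure j v w (x', l, y')) = 0" for x'
      using False by (simp add: pure_def fun_eq_iff)
    then have "(\<lambda>x'. \<beta> l k (\<lambda>y'. pure j v w (x', l, y')) y) = 0"
      by (simp only: hom2_zero[OF \<beta>]) (simp add: fun_eq_iff)
    then show ?thesis using False hom2_zero[OF \<alpha>] by (simp add: pure_def)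
  qed
  then show ?thesis
    using mem assms by (simp add: hcomp_def restr2_def comp1_def fun_eq_iff)
qed

lemma hcomp_hom2:
  assumes A: "A \<in> hom1 m p" and B: "B \<in> hom1 n m"
    and A': "A' \<in> hom1 m p" and B': "B' \<in> hom1 n m"
    and \<alpha>: "\<alpha> \<in> hom2 A A'" and \<beta>: "\<beta> \<in> hom2 B B'"
  shows "hcomp A B \<alpha> \<beta> \<in> hom2 (A \<bullet> B) (A' \<bullet> B')"
proof -
  have dims: "src A = m" "tgt A = p" "src B = n" "tgt B = m"
    "src A' = m" "tgt A' = p" "src B' = n" "tgt B' = m"
    using A B A' B' by (auto simp: hom1_def)
  have lin: "linear_map (ent (A \<bullet> B) i k) (ent (A' \<bullet> B') i k) (hcomp A B \<alpha> \<beta> i k)"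
    if i: "i < p" and k: "k < n" for i k
  proof -
    define P where "P = {pure j v w | j v w. j < m \<and> v \<in> ent A i j \<and> w \<in> ent B j k}"
    have ent: "ent (A \<bullet> B) i k = fun_space.span P"
      by (simp add: P_def comp1_def dims)
    define T where "T t = (\<lambda>(x, j, y). \<alpha> i j (\<lambda>x'. \<beta> j k (\<lambda>y'. t (x', j, y')) y) x)" for t
    have T: "hcomp A B \<alpha> \<beta> i k t = T t" if "t \<in> fun_space.span P" for t
      using that i k ent
      by (simp add: hcomp_def restr2_def T_def dims comp1_def)
    have sub_A: "fun_space.subspace (ent A i j)" if "j < m" for j
      using A i that by (auto simp: hom1_def)
    have sub_B: "fun_space.subspace (ent B j k)" if "j < m" for j
      using B k that by (auto simp: hom1_def)
    have \<beta>l: "linear_map (ent B j k) (ent B' j k) (\<beta> j k)" if "j < m" for j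
      using \<beta> k that by (auto simp: hom2_def dims)
    have \<alpha>l: "linear_map (ent A i j) (ent A' i j) (\<alpha> i j)" if "j < m" for j
      using \<alpha> i that by (auto simp: hom2_def dims)
    have out_\<alpha>: "\<alpha> i j v = 0" if "\<not> j < m" for j v
    proof -
      have "\<alpha> i j v = restr2 A \<alpha> i j v" using \<alpha> by (simp add: hom2_def)
      then show ?thesis using that by (simp add: restr2_def dims)
    qed
    have row: "(\<lambda>y'. t (x', j, y')) \<in> ent B j k" if "t \<in> fun_space.span P" "j < m" for t j x'
      using that(1)
    proof (induction rule: fun_space.span_induct_alt)
      case base
      then show ?case using fun_space.subspace_0[OF sub_B[OF that(2)]]
        by (simp add: zero_fun_def)
    next
      case (step c p t)
      then obtain l v w where p: "p = pure l v w" "v \<in> ent A i l" "w \<in> ent B l k"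
        by (auto simp: P_def)
      have "(\<lambda>y'. p (x', j, y')) \<in> ent B j k"
      proof (cases "l = j")
        case True
        have "(\<lambda>y'. p (x', j, y')) = fscale (v x') w"
          using True by (simp add: p pure_def fscale_def)
        then show ?thesis
          using fun_space.subspace_scale[OF sub_B[OF that(2)]] p True by simp
      next
        case False
        then have "(\<lambda>y'. p (x', j, y')) = 0" by (simp add: p pure_def fun_eq_iff)
        then show ?thesis using fun_space.subspace_0[OF sub_B[OF that(2)]] by simp
      qed
      then have "fscale c (\<lambda>y'. p (x', j, y')) + (\<lambda>y'. t (x', j, y')) \<in> ent B j k"
        using step sub_B[OF that(2)] fun_space.subspace_add fun_space.subspace_scale by blast
      moreover have "fscale c (\<lambda>y'. p (x', j, y')) + (\<lambda>y'. t (x', j, y')) =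
          (\<lambda>y'. (fscale c p + t) (x', j, y'))"
        by (simp add: fscale_def fun_eq_iff)
      ultimately show ?case by simp
    qed
    have radd: "\<beta> j k (\<lambda>y'. (s + t) (x', j, y')) =
        \<beta> j k (\<lambda>y'. s (x', j, y')) + \<beta> j k (\<lambda>y'. t (x', j, y'))"
      if "s \<in> fun_space.span P" "t \<in> fun_space.span P" "j < m" for s t j x'
    proof -
      have "(\<lambda>y'. (s + t) (x', j, y')) = (\<lambda>y'. s (x', j, y')) + (\<lambda>y'. t (x', j, y'))"
        by (simp add: fun_eq_iff)
      then show ?thesis
        using \<beta>l[OF that(3)] row[OF that(1,3)] row[OF that(2,3)] by (simp add: linear_map_def)
    qed
    have rsc: "\<beta> j k (\<lambda>y'. (fscale c t) (x', j, y')) = fscale c (\<beta> j k (\<lambda>y'. t (x', j, y')))"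
      if "t \<in> fun_space.span P" "j < m" for c t j x'
    proof -
      have "(\<lambda>y'. (fscale c t) (x', j, y')) = fscale c (\<lambda>y'. t (x', j, y'))"
        by (simp add: fscale_def fun_eq_iff)
      then show ?thesis using \<beta>l[OF that(2)] row[OF that(1,2)] by (simp add: linear_map_def)
    qed
    have base: "T p \<in> ent (A' \<bullet> B') i k
        \<and> (\<forall>j<m. \<forall>y. (\<lambda>x'. \<beta> j k (\<lambda>y'. p (x', j, y')) y) \<in> ent A i j)"
      if pP: "p \<in> P" for p
    proof -
      obtain l v w where p: "p = pure l v w" "l < m" "v \<in> ent A i l" "w \<in> ent B l k"
        using pP by (auto simp: P_def)
      have "T p = hcomp A B \<alpha> \<beta> i k p"
        using T[OF fun_space.span_base[OF pP]] by simp
      also have "\<dots> = pure l (\<alpha> i l v) (\<beta> l k w)"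
        unfolding p by (rule hcomp_pure[OF _ _ _ _ \<alpha> \<beta>]) (use p i k dims in auto)
      also have "\<dots> \<in> ent (A' \<bullet> B') i k"
      proof -
        have "\<alpha> i l v \<in> ent A' i l" "\<beta> l k w \<in> ent B' l k"
          using p \<alpha>l[OF p(2)] \<beta>l[OF p(2)] by (auto simp: linear_map_def)
        then show ?thesis
          unfolding comp1_def using p(2) dims by (simp, intro fun_space.span_base) blast
      qed
      finally have 1: "T p \<in> ent (A' \<bullet> B') i k" .
      have "(\<lambda>x'. \<beta> j k (\<lambda>y'. p (x', j, y')) y) \<in> ent A i j" if j: "j < m" for j y
      proof (cases "j = l")
        case True
        have "\<beta> l k (fscale (v x') w) = fscale (v x') (\<beta> l k w)" for x'
          using \<beta>l[OF p(2)] p by (simp add: linear_map_def)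
        then have "(\<lambda>x'. \<beta> j k (\<lambda>y'. p (x', j, y')) y) = fscale (\<beta> l k w y) v"
          using True by (simp add: p pure_def fscale_def fun_eq_iff mult.commute)
        then show ?thesis
          using True p fun_space.subspace_scale[OF sub_A[OF p(2)]] by simp
      next
        case False
        then have "(\<lambda>y'. p (x', j, y')) = 0" for x' by (simp add: p pure_def fun_eq_iff)
        then have "(\<lambda>x'. \<beta> j k (\<lambda>y'. p (x', j, y')) y) = 0"
          by (simp only: hom2_zero[OF \<beta>]) (simp add: fun_eq_iff)
        then show ?thesis using fun_space.subspace_0[OF sub_A[OF j]] by simp
      qed
      with 1 show ?thesis by blast
    qed
    have Tadd_gen: "T (s + t) = T s + T t"
      if "s \<in> fun_space.span P" "t \<in> fun_space.span P"
        "\<forall>j<m. \<forall>y. (\<lambda>x'. \<beta> j k (\<lambda>y'. s (x', j, y')) y) \<in> ent A i j"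
        "\<forall>j<m. \<forall>y. (\<lambda>x'. \<beta> j k (\<lambda>y'. t (x', j, y')) y) \<in> ent A i j" for s t
    proof -
      have "T (s + t) (x, j, y) = T s (x, j, y) + T t (x, j, y)" for x j y
      proof (cases "j < m")
        case True
        have "(\<lambda>x'. \<beta> j k (\<lambda>y'. (s + t) (x', j, y')) y) =
            (\<lambda>x'. \<beta> j k (\<lambda>y'. s (x', j, y')) y) + (\<lambda>x'. \<beta> j k (\<lambda>y'. t (x', j, y')) y)"
          using radd[OF that(1,2) True] by (simp add: fun_eq_iff)
        then show ?thesis
          unfolding T_def prod.case using \<alpha>l[OF True] that(3,4) True
          by (simp only: linear_map_def) simp
      qed (simp add: T_def out_\<alpha>)
      then show ?thesis by (auto simp: fun_eq_iff)
    qed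
    have Tsc_gen: "T (fscale c t) = fscale c (T t)"
      if "t \<in> fun_space.span P"
        "\<forall>j<m. \<forall>y. (\<lambda>x'. \<beta> j k (\<lambda>y'. t (x', j, y')) y) \<in> ent A i j" for c t
    proof -
      have "T (fscale c t) (x, j, y) = c * T t (x, j, y)" for x j y
      proof (cases "j < m")
        case True
        have "(\<lambda>x'. \<beta> j k (\<lambda>y'. (fscale c t) (x', j, y')) y) =
            fscale c (\<lambda>x'. \<beta> j k (\<lambda>y'. t (x', j, y')) y)"
          using rsc[OF that(1) True] by (simp add: fun_eq_iff fscale_def)
        moreover have "\<alpha> i j (fscale c (\<lambda>x'. \<beta> j k (\<lambda>y'. t (x', j, y')) y)) =
            fscale c (\<alpha> i j (\<lambda>x'. \<beta> j k (\<lambda>y'. t (x', j, y')) y))"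
          using \<alpha>l[OF True] that(2) True unfolding linear_map_def by blast
        ultimately show ?thesis
          unfolding T_def prod.case by (simp add: fscale_def)
      qed (simp add: T_def out_\<alpha>)
      then show ?thesis by (auto simp: fun_eq_iff fscale_def)
    qed
    have col: "t \<in> fun_space.span P \<and> T t \<in> ent (A' \<bullet> B') i k
        \<and> (\<forall>j<m. \<forall>y. (\<lambda>x'. \<beta> j k (\<lambda>y'. t (x', j, y')) y) \<in> ent A i j)"
      if "t \<in> fun_space.span P" for t
      using that
    proof (induction rule: fun_space.span_induct_alt)
      case base
      have "(\<lambda>x'. \<beta> j k (\<lambda>y'. 0) y) = 0" for j y
        using hom2_zero[OF \<beta>, of j k] by (simp add: fun_eq_iff zero_fun_def)
      then have 0: "(\<lambda>x'. \<beta> j k (\<lambda>y'. (0 :: 'a \<times> nat \<times> 'c \<Rightarrow> 'b) (x', j, y')) y) = 0" for j y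
        by simp
      have "T 0 (x, j, y) = 0" for x j y
        unfolding T_def prod.case 0 hom2_zero[OF \<alpha>] by simp
      then have "T 0 = 0" by (auto simp: fun_eq_iff)
      then have "T 0 \<in> ent (A' \<bullet> B') i k"
        by (simp only: comp1_def mat2.simps fun_space.span_zero)
      moreover have "\<forall>j<m. \<forall>y. (\<lambda>x'. \<beta> j k (\<lambda>y'. (0 :: 'a \<times> nat \<times> 'c \<Rightarrow> 'b) (x', j, y')) y)
          \<in> ent A i j"
        unfolding 0 using sub_A fun_space.subspace_0 by blast
      ultimately show ?case using fun_space.span_zero by blast
    next
      case (step c p t)
      have ps: "p \<in> fun_space.span P"
        using step(1) by (rule fun_space.span_base)
      then have tsc: "fscale c p \<in> fun_space.span P"
        by (rule fun_space.span_scale)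
      have ts: "t \<in> fun_space.span P" using step by simp
      note bp = base[OF step(1)]
      have cp: "\<forall>j<m. \<forall>y. (\<lambda>x'. \<beta> j k (\<lambda>y'. (fscale c p) (x', j, y')) y) \<in> ent A i j"
      proof (intro allI impI)
        fix j y assume j: "j < m"
        have "(\<lambda>x'. \<beta> j k (\<lambda>y'. (fscale c p) (x', j, y')) y) =
            fscale c (\<lambda>x'. \<beta> j k (\<lambda>y'. p (x', j, y')) y)"
          using rsc[OF ps j] by (simp add: fun_eq_iff fscale_def)
        then show "(\<lambda>x'. \<beta> j k (\<lambda>y'. (fscale c p) (x', j, y')) y) \<in> ent A i j"
          using bp j fun_space.subspace_scale[OF sub_A[OF j]] by simp
      qed
      have "T (fscale c p + t) = fscale c (T p) + T t"
        using Tadd_gen[OF tsc ts cp] Tsc_gen[OF ps] bp step by simp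
      moreover have "fun_space.subspace (ent (A' \<bullet> B') i k)"
        by (simp add: comp1_def)
      ultimately have 1: "T (fscale c p + t) \<in> ent (A' \<bullet> B') i k"
        using bp step fun_space.subspace_add fun_space.subspace_scale by metis
      have "(\<lambda>x'. \<beta> j k (\<lambda>y'. (fscale c p + t) (x', j, y')) y) \<in> ent A i j" if j: "j < m" for j y
      proof -
        have "(\<lambda>x'. \<beta> j k (\<lambda>y'. (fscale c p + t) (x', j, y')) y) =
            (\<lambda>x'. \<beta> j k (\<lambda>y'. (fscale c p) (x', j, y')) y) + (\<lambda>x'. \<beta> j k (\<lambda>y'. t (x', j, y')) y)"
          using radd[OF tsc ts j] by (simp add: fun_eq_iff)
        then show ?thesis using cp step j fun_space.subspace_add[OF sub_A[OF j]] by simp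
      qed
      with 1 show ?case using fun_space.span_add[OF tsc ts] by blast
    qed
    show ?thesis
      unfolding linear_map_def ent
    proof (intro conjI ballI allI)
      fix t assume t: "t \<in> fun_space.span P"
      show "hcomp A B \<alpha> \<beta> i k t \<in> ent (A' \<bullet> B') i k"
        using T[OF t] col[OF t] by simp
      show "hcomp A B \<alpha> \<beta> i k (fscale c t) = fscale c (hcomp A B \<alpha> \<beta> i k t)" for c
        using T[OF t] T[OF fun_space.span_scale[OF t]] Tsc_gen[OF t] col[OF t] by simp
    next
      fix s t assume s: "s \<in> fun_space.span P" and t: "t \<in> fun_space.span P"
      show "hcomp A B \<alpha> \<beta> i k (s + t) = hcomp A B \<alpha> \<beta> i k s + hcomp A B \<alpha> \<beta> i k t"
        using T[OF s] T[OF t] T[OF fun_space.span_add[OF s t]] Tadd_gen[OF s t] col[OF s] col[OF t]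
        by simp
    qed
  qed
  have "restr2 (A \<bullet> B) (hcomp A B \<alpha> \<beta>) = hcomp A B \<alpha> \<beta>"
    by (auto simp: hcomp_def restr2_def fun_eq_iff)
  then show ?thesis using lin dims by (auto simp: hom2_def comp1_def)
qed


section \<open>2-representations\<close>

record ('g, 'i, 'k) rep2 =
  deg :: nat
  rho :: "'g \<Rightarrow> ('i, 'k) mat2"
  phi1 :: "('i, unit, 'k) mor2"
  phi :: "'g \<Rightarrow> 'g \<Rightarrow> ('i \<times> nat \<times> 'i, 'i, 'k) mor2"

definition is_rep2 :: "('g, 'x) monoid_scheme \<Rightarrow> ('g, 'i, 'k::field) rep2 \<Rightarrow> bool"
  where "is_rep2 G R \<longleftrightarrow>
    (\<forall>g\<in>carrier G. rho R g \<in> hom1 (deg R) (deg R)) \<and>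
    iso2 (rho R \<one>\<^bsub>G\<^esub>) (one1 (deg R)) (phi1 R) \<and>
    (\<forall>g\<in>carrier G. \<forall>h\<in>carrier G.
      iso2 (rho R g \<bullet> rho R h) (rho R (g \<otimes>\<^bsub>G\<^esub> h)) (phi R g h)) \<and>
    (\<forall>g\<in>carrier G. \<forall>h\<in>carrier G. \<forall>l\<in>carrier G.
      phi R (g \<otimes>\<^bsub>G\<^esub> h) l \<cdot> rwhisk (rho R g \<bullet> rho R h) (rho R l) (phi R g h) =
      phi R g (h \<otimes>\<^bsub>G\<^esub> l) \<cdot> lwhisk (rho R g) (rho R h \<bullet> rho R l) (phi R h l) \<cdot>
        assoc (rho R g) (rho R h) (rho R l)) \<and>
    (\<forall>g\<in>carrier G.
      phi R \<one>\<^bsub>G\<^esub> g = lunit (rho R g) \<cdot> rwhisk (rho R \<one>\<^bsub>G\<^esub>) (rho R g) (phi1 R) \<and>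
      phi R g \<one>\<^bsub>G\<^esub> = runit (rho R g) \<cdot> lwhisk (rho R g) (rho R \<one>\<^bsub>G\<^esub>) (phi1 R))"

definition weakly_invertible :: "('i, 'k::field) mat2 \<Rightarrow> bool"
  where "weakly_invertible f \<longleftrightarrow> (\<exists>h :: ('i, 'k) mat2. h \<in> hom1 (tgt f) (src f) \<and>
    (\<exists>\<eta>. iso2 (f \<bullet> h) (one1 (tgt f)) \<eta>) \<and> (\<exists>\<epsilon>. iso2 (h \<bullet> f) (one1 (src f)) \<epsilon>))"

text \<open>The type argument fixes the function space \<open>'u \<Rightarrow> 'k\<close> whose subspaces are the entries of the
  1-morphism \<open>f\<close> (and of its weak inverse); HOL cannot quantify over \<open>'u\<close> inside a definition.
  The choice is immaterial, as the entries of a weakly invertible 2-matrix have dimension at most 1.\<close>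

definition equivalent2 :: "'u itself \<Rightarrow> ('g, 'x) monoid_scheme \<Rightarrow>
    ('g, 'i, 'k::field) rep2 \<Rightarrow> ('g, 'j, 'k) rep2 \<Rightarrow> bool"
  where "equivalent2 _ G R R' \<longleftrightarrow>
    (\<exists>(f :: ('u, 'k) mat2) \<psi>.
      f \<in> hom1 (deg R) (deg R') \<and> weakly_invertible f \<and>
      (\<forall>g\<in>carrier G. iso2 (rho R' g \<bullet> f) (f \<bullet> rho R g) (\<psi> g)) \<and>
      (\<forall>g\<in>carrier G. \<forall>h\<in>carrier G.
        \<psi> (g \<otimes>\<^bsub>G\<^esub> h) \<cdot> rwhisk (rho R' g \<bullet> rho R' h) f (phi R' g h) =
        lwhisk f (rho R g \<bullet> rho R h) (phi R g h) \<cdot>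
        assoc f (rho R g) (rho R h) \<cdot>
        rwhisk (rho R' g \<bullet> f) (rho R h) (\<psi> g) \<cdot>
        assoc_inv (rho R' g) f (rho R h) \<cdot>
        lwhisk (rho R' g) (rho R' h \<bullet> f) (\<psi> h) \<cdot>
        assoc (rho R' g) (rho R' h) f) \<and>
      lunit f \<cdot> rwhisk (rho R' \<one>\<^bsub>G\<^esub>) f (phi1 R') =
        runit f \<cdot> lwhisk f (rho R \<one>\<^bsub>G\<^esub>) (phi1 R) \<cdot> \<psi> \<one>\<^bsub>G\<^esub>)"


section \<open>2-characters\<close>

definition cat_trace :: "('i, 'k::field) mat2 \<Rightarrow> (unit, 'i, 'k) mor2 set"
  where "cat_trace F = hom2 (one1 (src F)) F"

text \<open>\<open>rho g \<circ> \<phi> \<circ> rho (inv g)\<close> is formed as \<open>rho g \<circ> (\<phi> \<circ> rho (inv g))\<close>.\<close>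

definition conj2 :: "('g, 'x) monoid_scheme \<Rightarrow> ('g, 'i, 'k::field) rep2 \<Rightarrow> 'g \<Rightarrow> 'g \<Rightarrow>
    (unit, 'i, 'k) mor2 \<Rightarrow> (unit, 'i, 'k) mor2"
  where "conj2 G R g h \<phi> =
    (let g' = inv\<^bsub>G\<^esub> g; I = one1 (deg R) in
      phi R g (h \<otimes>\<^bsub>G\<^esub> g') \<cdot>
      lwhisk (rho R g) (rho R h \<bullet> rho R g') (phi R h g') \<cdot>
      lwhisk (rho R g) (I \<bullet> rho R g') (rwhisk I (rho R g') \<phi>) \<cdot>
      lwhisk (rho R g) (rho R g') (lunit_inv (rho R g')) \<cdot>
      inv2 (rho R g \<bullet> rho R g') (rho R (g \<otimes>\<^bsub>G\<^esub> g')) (phi R g g') \<cdot>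
      inv2 (rho R \<one>\<^bsub>G\<^esub>) I (phi1 R))"

definition character2 :: "('g, 'x) monoid_scheme \<Rightarrow> ('g, 'i, 'k::field) rep2 \<Rightarrow> 'g \<Rightarrow> 'g \<Rightarrow> 'k"
  where "character2 G R g h = mor_space.trace_on (cat_trace (rho R h)) (conj2 G R g h)"

definition same_character2 :: "('g, 'x) monoid_scheme \<Rightarrow>
    ('g, 'i, 'k::field) rep2 \<Rightarrow> ('g, 'j, 'k) rep2 \<Rightarrow> bool"
  where "same_character2 G R R' \<longleftrightarrow>
    (\<forall>g\<in>carrier G. \<forall>h\<in>carrier G. g \<otimes>\<^bsub>G\<^esub> h = h \<otimes>\<^bsub>G\<^esub> g \<longrightarrow>
      character2 G R g h = character2 G R' g h)"


section \<open>G-sets and the associated 2-representations\<close>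

type_synonym ('g, 's) gset = "'s set \<times> ('g \<Rightarrow> 's \<Rightarrow> 's)"

definition regular_gset :: "('g, 'x) monoid_scheme \<Rightarrow> ('g, 'g) gset"
  where "regular_gset G = (carrier G, \<lambda>g. \<lambda>x\<in>carrier G. g \<otimes>\<^bsub>G\<^esub> x)"

definition point_gset :: "('g, unit) gset"
  where "point_gset = ({()}, \<lambda>g. \<lambda>x\<in>{()}. x)"

definition coset_gset :: "('g, 'x) monoid_scheme \<Rightarrow> 'g set \<Rightarrow> ('g, 'g set) gset"
  where "coset_gset G H = (lcosets\<^bsub>G\<^esub> H, \<lambda>g. \<lambda>C\<in>lcosets\<^bsub>G\<^esub> H. g <#\<^bsub>G\<^esub> C)"

definition gset_sum :: "('g, 's) gset \<Rightarrow> ('g, 't) gset \<Rightarrow> ('g, 's + 't) gset"  (infixr "\<squnion>" 65)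
  where "S \<squnion> T = (fst S <+> fst T, \<lambda>g. \<lambda>x\<in>fst S <+> fst T. map_sum (snd S g) (snd T g) x)"

text \<open>The list \<open>xs\<close> is the chosen ordering of the \<open>G\<close>-set. The identity 2-morphism
  \<open>rho g \<circ> rho h \<Rightarrow> rho (g h)\<close> involves the canonical isomorphism \<open>\<Oplus>\<^sub>j V\<^sub>j \<otimes> W\<^sub>j \<cong> k\<close> for a family of
  spaces \<open>V\<^sub>j, W\<^sub>j \<in> {0, k}\<close> in which exactly one tensor product is nonzero; on that summand it is
  the multiplication \<open>k \<otimes> k \<cong> k\<close>.\<close>

definition perm_mat2 :: "('g, 's) gset \<Rightarrow> 's list \<Rightarrow> 'g \<Rightarrow> (unit, 'k::field) mat2"
  where "perm_mat2 S xs g = \<lparr>tgt = length xs, src = length xs,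
    ent = (\<lambda>i j. if xs ! i = snd S g (xs ! j) then UNIV else {0})\<rparr>"

definition gset_rep2 :: "('g, 'x) monoid_scheme \<Rightarrow> ('g, 's) gset \<Rightarrow> 's list \<Rightarrow>
    ('g, unit, 'k::field) rep2"
  where "gset_rep2 G S xs = \<lparr>deg = length xs, rho = perm_mat2 S xs,
    phi1 = id2 (perm_mat2 S xs \<one>\<^bsub>G\<^esub>),
    phi = (\<lambda>g h. restr2 (perm_mat2 S xs g \<bullet> perm_mat2 S xs h)
      (\<lambda>_ _ t _. \<Sum>j<length xs. t ((), j, ())))\<rparr>"

abbreviation Sigma3 :: "(nat \<Rightarrow> nat) monoid"
  where "Sigma3 \<equiv> sym_group 3"

definition S_gset :: "(nat \<Rightarrow> nat, (nat \<Rightarrow> nat) + unit + unit) gset"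
  where "S_gset = regular_gset Sigma3 \<squnion> point_gset \<squnion> point_gset"

definition S'_gset ::
    "(nat \<Rightarrow> nat, (nat \<Rightarrow> nat) set + (nat \<Rightarrow> nat) set + (nat \<Rightarrow> nat) set) gset"
  where "S'_gset =
    coset_gset Sigma3 (generate Sigma3 {cycle_of_list [1, 2]}) \<squnion>
    coset_gset Sigma3 (generate Sigma3 {cycle_of_list [1, 2]}) \<squnion>
    coset_gset Sigma3 (generate Sigma3 {cycle_of_list [1, 2, 3]})"

end

theory Submission
  imports Defs
begin

text \<open>
  All 2-matrices attached to a \<open>G\<close>-set have exactly one nonzero entry in each column, a line with a
  chosen basis vector, so a 2-morphism between them is one scalar per column. In this calculus all
  structure maps have coefficients 1, and \<open>\<psi>\<^sub>g(h)\<close> permutes the basis of the categorical trace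
  indexed by the fixed points of \<open>h\<close>; hence \<open>\<chi>(g, h)\<close> is the number of common fixed points of \<open>g\<close>
  and \<open>h\<close>. Commuting pairs in \<open>\<Sigma>\<^sub>3\<close> generate cyclic subgroups, and \<open>S\<close> and \<open>S'\<close> have equally many
  fixed points under each cyclic subgroup (8 for the trivial one, 2 otherwise). But the support of a
  weakly invertible 2-matrix is a permutation, so an equivalence would carry the fixed points of
  \<open>\<Sigma>\<^sub>3\<close> in \<open>S\<close> to fixed points in \<open>S'\<close>, which has none.
\<close>

section \<open>Basis independence of the trace\<close>

context vector_space
begin

text \<open>\<open>trace_on\<close> chooses its basis, so computing with it requires independence of
  the choice. Multiply the \<open>C\<close>-coordinates of the elements of \<open>B\<close> by the
  \<open>B\<close>-coordinates of the vectors \<open>T c\<close>: both traces are the double sum of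
  these products, taken in the two orders.\<close>

lemma sum_representation_basis_change:
  assumes B: "finite B" "independent B" "span B = V"
    and C: "finite C" "independent C" "span C = V"
    and T: "\<And>v. v \<in> V \<Longrightarrow> T v \<in> V"
    and add: "\<And>v w. v \<in> V \<Longrightarrow> w \<in> V \<Longrightarrow> T (v + w) = T v + T w"
    and scl: "\<And>c v. v \<in> V \<Longrightarrow> T (scale c v) = scale c (T v)"
  shows "(\<Sum>b\<in>B. representation B (T b) b) = (\<Sum>c\<in>C. representation C (T c) c)"
proof -
  have sub: "subspace V"
    using B(3) subspace_span by blast
  have T0: "T 0 = 0"
    using scl[of 0 0] subspace_0[OF sub] by simp
  \<comment> \<open>\<open>T\<close> is linear on \<open>V\<close> only, so each partial sum has to
    be kept inside \<open>V\<close>.\<close>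
  have Tsum: "T (\<Sum>c\<in>A. scale (r c) c) = (\<Sum>c\<in>A. scale (r c) (T c))"
    if "finite A" "A \<subseteq> V" for A r
    using that
  proof (induction A)
    case (insert x A)
    have "(\<Sum>c\<in>A. scale (r c) c) \<in> V"
      using insert.prems sub by (intro subspace_sum) (auto intro: subspace_scale)
    then show ?case
      using insert sub by (simp add: add scl subspace_scale)
  qed (simp add: T0)
  have BV: "b \<in> V" if "b \<in> B" for b
    using that B(3) span_base by blast
  have CV: "c \<in> V" if "c \<in> C" for c
    using that C(3) span_base by blast
  have expand: "representation B (T b) b =
      (\<Sum>c\<in>C. representation C b c * representation B (T c) b)" if "b \<in> B" for b
  proof -
    have "b = (\<Sum>c\<in>C. scale (representation C b c) c)"
      using sum_representation_eq[OF C(2) _ C(1) order_refl, of b] BV[OF that] C(3) by simp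
    then have "T b = (\<Sum>c\<in>C. scale (representation C b c) (T c))"
      using Tsum[OF C(1), of "representation C b"] CV by (simp add: subset_iff)
    then have "representation B (T b) b =
        representation B (\<Sum>c\<in>C. scale (representation C b c) (T c)) b"
      by simp
    also have "representation B (\<Sum>c\<in>C. scale (representation C b c) (T c)) = (\<lambda>x. \<Sum>c\<in>C. representation B (scale (representation C b c) (T c)) x)"
      using T CV B(3) sub by (intro representation_sum[OF B(2)]) (auto intro: subspace_scale)
    also have "(\<Sum>c\<in>C. representation B (scale (representation C b c) (T c)) b) = (\<Sum>c\<in>C. representation C b c * representation B (T c) b)"
      using T CV B(3) by (intro sum.cong) (simp_all add: representation_scale[OF B(2)])
    finally show ?thesis .
  qed
  have collect: "(\<Sum>b\<in>B. representation C b c * representation B (T c) b) = representation C (T c) c"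
    if "c \<in> C" for c
  proof -
    have "T c = (\<Sum>b\<in>B. scale (representation B (T c) b) b)"
      using sum_representation_eq[OF B(2) _ B(1) order_refl, of "T c"] T CV[OF that] B(3) by simp
    then have "representation C (T c) c =
        representation C (\<Sum>b\<in>B. scale (representation B (T c) b) b) c"
      by simp
    also have "representation C (\<Sum>b\<in>B. scale (representation B (T c) b) b) = (\<lambda>x. \<Sum>b\<in>B. representation C (scale (representation B (T c) b) b) x)"
      using BV C(3) sub by (intro representation_sum[OF C(2)]) (auto intro: subspace_scale)
    also have "(\<Sum>b\<in>B. representation C (scale (representation B (T c) b) b) c) = (\<Sum>b\<in>B. representation C b c * representation B (T c) b)"
      using BV C(3) by (intro sum.cong) (simp_all add: representation_scale[OF C(2)])
    finally show ?thesis by simp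
  qed
  have "(\<Sum>b\<in>B. representation B (T b) b) =
      (\<Sum>b\<in>B. \<Sum>c\<in>C. representation C b c * representation B (T c) b)"
    by (intro sum.cong refl expand)
  also have "\<dots> = (\<Sum>c\<in>C. \<Sum>b\<in>B. representation C b c * representation B (T c) b)"
    by (rule sum.swap)
  also have "\<dots> = (\<Sum>c\<in>C. representation C (T c) c)"
    by (intro sum.cong refl collect)
  finally show ?thesis .
qed

lemma trace_on_basis:
  assumes "finite B" "independent B" "span B = V"
    and "\<And>v. v \<in> V \<Longrightarrow> T v \<in> V"
    and "\<And>v w. v \<in> V \<Longrightarrow> w \<in> V \<Longrightarrow> T (v + w) = T v + T w"
    and "\<And>c v. v \<in> V \<Longrightarrow> T (scale c v) = scale c (T v)"
  shows "trace_on V T = (\<Sum>b\<in>B. representation B (T b) b)"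
proof -
  define C where "C = (SOME C. finite C \<and> independent C \<and> span C = V)"
  have "finite C \<and> independent C \<and> span C = V"
    unfolding C_def by (rule someI[of _ B]) (use assms in blast)
  then show ?thesis
    unfolding trace_on_def Let_def C_def[symmetric]
    using sum_representation_basis_change[of C V B T] assms by blast
qed

end

section \<open>Monomial 2-matrices\<close>

text \<open>A line and the zero space under one condition: for \<open>i = f k\<close> the functions
  supported at \<open>a k\<close>, and for every other row just 0, because the implication then
  forbids nonzero values.\<close>

definition axis :: "(nat \<Rightarrow> nat) \<Rightarrow> (nat \<Rightarrow> 'i) \<Rightarrow> nat \<Rightarrow> nat \<Rightarrow> ('i \<Rightarrow> 'k::field) set"
  where "axis f a i k = {t. \<forall>x. t x \<noteq> 0 \<longrightarrow> i = f k \<and> x = a k}"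

text \<open>The only nonzero entry in column \<open>k\<close> is in row \<open>f k\<close>, and it is the line of functions
  supported at \<open>a k\<close>.\<close>

definition monomial :: "nat \<Rightarrow> (nat \<Rightarrow> nat) \<Rightarrow> (nat \<Rightarrow> 'i) \<Rightarrow> ('i, 'k::field) mat2 \<Rightarrow> bool"
  where "monomial n f a A \<longleftrightarrow> src A = n \<and> tgt A = n \<and> (\<forall>k<n. f k < n) \<and>
    (\<forall>i<n. \<forall>k<n. ent A i k = axis f a i k)"

text \<open>In column \<open>k\<close>, the basis vector at \<open>a k\<close> is sent to \<open>c k\<close> times the basis vector at \<open>b k\<close>.\<close>

definition monomial_mor :: "nat \<Rightarrow> (nat \<Rightarrow> nat) \<Rightarrow> (nat \<Rightarrow> 'i) \<Rightarrow> (nat \<Rightarrow> 'j) \<Rightarrow> (nat \<Rightarrow> 'k::field) \<Rightarrow>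
    ('i, 'j, 'k) mor2"
  where "monomial_mor n f a b c = (\<lambda>i k t y.
    if i < n \<and> k < n \<and> t \<in> axis f a i k \<and> i = f k \<and> y = b k then c k * t (a k) else 0)"

lemma monomial_mor_cong:
  assumes "\<And>k. k < n \<Longrightarrow> f k = f' k" "\<And>k. k < n \<Longrightarrow> a k = a' k" "\<And>k. k < n \<Longrightarrow> b k = b' k"
    "\<And>k. k < n \<Longrightarrow> c k = c' k"
  shows "monomial_mor n f a b c = monomial_mor n f' a' b' c'"
  unfolding monomial_mor_def axis_def using assms by (auto intro!: ext)

lemma monomial_mor_zero [simp]:
  "monomial_mor n f a b c i k 0 = 0" "monomial_mor n f a b c i k (\<lambda>_. 0) = 0"
  by (auto simp: monomial_mor_def fun_eq_iff)

lemma zero_in_axis [simp]: "0 \<in> axis f a i k" "(\<lambda>_. 0) \<in> axis f a i k"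
  by (auto simp: axis_def)

lemma subspace_axis: "fun_space.subspace (axis f a i k)"
  unfolding fun_space.subspace_def
  by (auto simp: axis_def fscale_def) (metis add.left_neutral)+

lemma monomial_hom1: "monomial n f a A \<Longrightarrow> A \<in> hom1 n n"
  by (auto simp: monomial_def hom1_def subspace_axis)

text \<open>Column \<open>k\<close> of \<open>B\<close> is concentrated in row \<open>g k\<close>,
  so only the summand \<open>j = g k\<close> survives, and the tensor product of two lines is a
  line. The middle component of the support point records that summand.\<close>

lemma monomial_comp1:
  assumes "monomial n f a A" "monomial n g b B"
  shows "monomial n (\<lambda>k. f (g k)) (\<lambda>k. (a (g k), g k, b k)) (A \<bullet> B)"
proof -
  let ?h = "\<lambda>k. (a (g k), g k, b k)"
  have "fun_space.span {pure j v w | j v w. j < n \<and> v \<in> ent A i j \<and> w \<in> ent B j k} =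
      axis (\<lambda>k. f (g k)) ?h i k" (is "fun_space.span ?P = _")
    if i: "i < n" and k: "k < n" for i k
  proof
    show "fun_space.span ?P \<subseteq> axis (\<lambda>k. f (g k)) ?h i k"
    proof (rule fun_space.span_minimal[OF _ subspace_axis])
      show "?P \<subseteq> axis (\<lambda>k. f (g k)) ?h i k"
      proof clarify
        fix j v w
        assume j: "j < n" "v \<in> ent A i j" "w \<in> ent B j k"
        then have v: "v \<in> axis f a i j" and w: "w \<in> axis g b j k"
          using assms i k by (simp_all add: monomial_def)
        show "pure j v w \<in> axis (\<lambda>k. f (g k)) ?h i k"
          unfolding axis_def
        proof clarify
          fix x l y
          assume "pure j v w (x, l, y) \<noteq> 0"
          then have "l = j" "v x \<noteq> 0" "w y \<noteq> 0"
            by (auto simp: pure_def split: if_splits)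
          with v w show "i = f (g k) \<and> (x, l, y) = ?h k"
            by (auto simp: axis_def)
        qed
      qed
    qed
    show "axis (\<lambda>k. f (g k)) ?h i k \<subseteq> fun_space.span ?P"
    proof
      fix t :: "'a \<times> nat \<times> 'c \<Rightarrow> 'b"
      assume t: "t \<in> axis (\<lambda>k. f (g k)) ?h i k"
      show "t \<in> fun_space.span ?P"
      proof (cases "i = f (g k)")
        case True
        \<comment> \<open>A tensor on the line is split by putting its whole scalar into the first
          factor and the unit basis vector into the second.\<close>
        let ?v = "\<lambda>x. if x = a (g k) then t (?h k) else 0"
        let ?w = "\<lambda>y. if y = b k then 1 else 0"
        have "t = pure (g k) ?v ?w"
          using t by (auto simp: axis_def pure_def fun_eq_iff)
        moreover have "pure (g k) ?v ?w \<in> ?P"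
        proof -
          have "g k < n"
            using assms k by (simp add: monomial_def)
          moreover have "?v \<in> ent A i (g k)" "?w \<in> ent B (g k) k"
            using True assms i k by (auto simp: monomial_def axis_def)
          ultimately show ?thesis by blast
        qed
        ultimately show ?thesis
          by (simp add: fun_space.span_base)
      next
        case False
        then have "t = 0"
          using t by (auto simp: axis_def fun_eq_iff)
        then show ?thesis
          by (simp add: fun_space.span_zero)
      qed
    qed
  qed
  then show ?thesis
    using assms by (simp add: monomial_def comp1_def)
qed

lemma monomial_one1: "monomial n (\<lambda>k. k) (\<lambda>_. ()) (one1 n)"
  by (auto simp: monomial_def one1_def axis_def fun_eq_iff)

section \<open>Monomial form of composites, inverses and structure 2-isomorphisms\<close>

lemma restr2_eq_monomial_mor:
  assumes "monomial n f a A"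
    and "\<And>k t y. k < n \<Longrightarrow> t \<in> axis f a (f k) k \<Longrightarrow>
      \<alpha> (f k) k t y = (if y = b k then c k * t (a k) else 0)"
    and "\<And>i k. i < n \<Longrightarrow> k < n \<Longrightarrow> i \<noteq> f k \<Longrightarrow> \<alpha> i k 0 = 0"
  shows "restr2 A \<alpha> = monomial_mor n f a b c"
proof (intro ext)
  fix i k t y
  show "restr2 A \<alpha> i k t y = monomial_mor n f a b c i k t y"
  proof (cases "i < n \<and> k < n \<and> t \<in> axis f a i k")
    case True
    show ?thesis
    proof (cases "i = f k")
      \<comment> \<open>Away from the support the entry is \<open>{0}\<close>, so only the value of
        \<open>\<alpha>\<close> at 0 has to be known there.\<close>
      case False
      then have "t = 0"
        using True by (auto simp: axis_def fun_eq_iff)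
      then show ?thesis
        using assms True False by (auto simp: monomial_def monomial_mor_def restr2_def)
    qed (use assms True in \<open>auto simp: monomial_def monomial_mor_def restr2_def\<close>)
  qed (use assms in \<open>auto simp: monomial_def monomial_mor_def restr2_def\<close>)
qed

lemma id2_monomial: "monomial n f a A \<Longrightarrow> id2 A = monomial_mor n f a a (\<lambda>_. 1)"
  unfolding id2_def by (rule restr2_eq_monomial_mor) (auto simp: axis_def)

text \<open>The middle supports need to match only in columns with nonzero \<open>c k\<close>; in
  the others the inner map, and hence the composite, is 0. This freedom covers 2-morphisms from the
  identity to \<open>\<rho>_h\<close>, whose supports agree only at fixed points of
  \<open>h\<close>.\<close>

lemma vcomp_monomial_mor:
  assumes "\<And>k. k < n \<Longrightarrow> c k \<noteq> 0 \<Longrightarrow> f' k = f k \<and> b' k = b k"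
  shows "monomial_mor n f' b' d e \<cdot> monomial_mor n f a b c = monomial_mor n f a d (\<lambda>k. e k * c k)"
proof (intro ext)
  fix i k t y
  let ?u = "monomial_mor n f a b c i k t"
  show "(monomial_mor n f' b' d e \<cdot> monomial_mor n f a b c) i k t y =
      monomial_mor n f a d (\<lambda>k. e k * c k) i k t y"
  proof (cases "i < n \<and> k < n \<and> t \<in> axis f a i k \<and> i = f k \<and> c k \<noteq> 0")
    case True
    then have eqs: "f' k = f k" "b' k = b k"
      using assms by blast+
    then have "?u \<in> axis f' b' i k" "?u (b k) = c k * t (a k)"
      using True by (auto simp: axis_def monomial_mor_def)
    then have "monomial_mor n f' b' d e i k ?u y = (if y = d k then e k * (c k * t (a k)) else 0)"
      using True eqs by (subst monomial_mor_def) simp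
    moreover have "monomial_mor n f a d (\<lambda>k. e k * c k) i k t y =
        (if y = d k then e k * (c k * t (a k)) else 0)"
      using True by (auto simp: monomial_mor_def)
    ultimately show ?thesis
      by (simp add: vcomp_def)
  next
    case False
    then have "?u = (\<lambda>_. 0)"
      by (auto simp: monomial_mor_def)
    then show ?thesis
      using False by (auto simp: vcomp_def monomial_mor_def)
  qed
qed

text \<open>Where the rows \<open>f k\<close> and \<open>f' k\<close> differ, the target entry in
  row \<open>f k\<close> is zero; the vanishing of \<open>c k\<close> makes the map land
  there.\<close>

lemma monomial_mor_hom2:
  assumes "monomial n f a A" "monomial n f' b B"
    and c: "\<And>k. k < n \<Longrightarrow> c k \<noteq> 0 \<Longrightarrow> f' k = f k"
  shows "monomial_mor n f a b c \<in> hom2 A B"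
proof -
  have "restr2 A (monomial_mor n f a b c) = monomial_mor n f a b c"
    using assms(1) by (auto simp: restr2_def monomial_mor_def monomial_def intro!: ext)
  moreover have "linear_map (axis f a i k) (axis f' b i k) (monomial_mor n f a b c i k)"
    if "i < n" "k < n" for i k
    unfolding linear_map_def
  proof (intro conjI ballI allI)
    fix v w :: "'a \<Rightarrow> 'b" and r
    assume v: "v \<in> axis f a i k"
    show "monomial_mor n f a b c i k v \<in> axis f' b i k"
      using c that by (auto simp: axis_def monomial_mor_def)
    show "monomial_mor n f a b c i k (fscale r v) = fscale r (monomial_mor n f a b c i k v)"
      using that v fun_space.subspace_scale[OF subspace_axis v, of r]
      by (auto simp: monomial_mor_def fscale_def fun_eq_iff)
    assume w: "w \<in> axis f a i k"
    show "monomial_mor n f a b c i k (v + w) =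
        monomial_mor n f a b c i k v + monomial_mor n f a b c i k w"
      using that v w fun_space.subspace_add[OF subspace_axis v w]
      by (auto simp: monomial_mor_def fun_eq_iff algebra_simps)
  qed
  ultimately show ?thesis
    using assms by (auto simp: hom2_def monomial_def)
qed

lemma monomial_mor_iso2:
  assumes "monomial n f a A" "monomial n f' b B" "\<And>k. k < n \<Longrightarrow> f' k = f k"
  shows "iso2 A B (monomial_mor n f a b (\<lambda>_. 1))"
  unfolding iso2_def
proof (intro conjI bexI)
  show "monomial_mor n f a b (\<lambda>_. 1) \<in> hom2 A B" "monomial_mor n f' b a (\<lambda>_. 1) \<in> hom2 B A"
    using assms by (auto intro!: monomial_mor_hom2)
  show "monomial_mor n f' b a (\<lambda>_. 1) \<cdot> monomial_mor n f a b (\<lambda>_. 1) = id2 A"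
    unfolding id2_monomial[OF assms(1)] using assms(3) by (subst vcomp_monomial_mor) simp_all
  show "monomial_mor n f a b (\<lambda>_. 1) \<cdot> monomial_mor n f' b a (\<lambda>_. 1) = id2 B"
    unfolding id2_monomial[OF assms(2)] using assms(3) by (subst vcomp_monomial_mor) simp_all
qed

text \<open>\<open>inv2\<close> is defined through \<open>inv_into\<close>, whose value becomes
  explicit once the map is injective on the entry and a preimage of \<open>t\<close> is
  exhibited.\<close>

lemma inv2_monomial_mor:
  assumes A: "monomial n f a A" and B: "monomial n f' b B" and f: "\<And>k. k < n \<Longrightarrow> f' k = f k"
  shows "inv2 A B (monomial_mor n f a b (\<lambda>_. 1)) = monomial_mor n f' b a (\<lambda>_. 1)"
  unfolding inv2_def
proof (rule restr2_eq_monomial_mor[OF B])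
  let ?\<alpha> = "monomial_mor n f a b (\<lambda>_. 1)"
  have inv: "inv_into (ent A i k) (?\<alpha> i k) t = (\<lambda>x. if x = a k \<and> i = f k then t (b k) else 0)"
    if "i < n" "k < n" "t \<in> axis f' b i k" for i k t
  proof -
    let ?s = "\<lambda>x. if x = a k \<and> i = f k then t (b k) else 0"
    have ent: "ent A i k = axis f a i k"
      using A that by (simp add: monomial_def)
    have inj: "inj_on (?\<alpha> i k) (axis f a i k)"
    proof (rule inj_onI)
      fix u v
      assume uv: "u \<in> axis f a i k" "v \<in> axis f a i k" "?\<alpha> i k u = ?\<alpha> i k v"
      have "u x = v x" for x
      proof (cases "i = f k \<and> x = a k")
        case True
        then show ?thesis
          using fun_cong[OF uv(3), of "b k"] uv that by (simp add: monomial_mor_def)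
      next
        case False
        then have "u x = 0" "v x = 0"
          using uv by (auto simp: axis_def)
        then show ?thesis by simp
      qed
      then show "u = v" by (rule ext)
    qed
    have s: "?s \<in> axis f a i k"
      by (auto simp: axis_def)
    have "?\<alpha> i k ?s y = t y" for y
    proof (cases "i = f k \<and> y = b k")
      case True
      then show ?thesis
        using that s by (auto simp: monomial_mor_def)
    next
      case False
      then have "t y = 0"
        using that f by (auto simp: axis_def)
      then show ?thesis
        using False by (auto simp: monomial_mor_def)
    qed
    then have "?\<alpha> i k ?s = t" by (rule ext)
    then show ?thesis
      using inv_into_f_f[OF inj s] ent by simp
  qed
  show "inv_into (ent A (f' k) k) (?\<alpha> (f' k) k) t x = (if x = a k then 1 * t (b k) else 0)"
    if "k < n" "t \<in> axis f' b (f' k) k" for k t x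
    using inv[of "f' k" k t] that B f by (auto simp: monomial_def)
  show "inv_into (ent A i k) (?\<alpha> i k) 0 = 0" if "i < n" "k < n" "i \<noteq> f' k" for i k
    using inv[of i k 0] that by (auto simp: fun_eq_iff)
qed

text \<open>The second factor carries column \<open>k\<close> to row \<open>g k\<close>, which is
  the column in which the first factor acts; this is why its coefficient is
  \<open>c (g k)\<close>.\<close>

lemma hcomp_monomial_mor:
  assumes A: "monomial n f a A" and B: "monomial n g b B"
  shows "hcomp A B (monomial_mor n f a a' c) (monomial_mor n g b b' d) =
    monomial_mor n (\<lambda>k. f (g k)) (\<lambda>k. (a (g k), g k, b k)) (\<lambda>k. (a' (g k), g k, b' k))
      (\<lambda>k. c (g k) * d k)"
  unfolding hcomp_def
proof (rule restr2_eq_monomial_mor[OF monomial_comp1[OF A B]])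
  let ?\<alpha> = "monomial_mor n f a a' c" and ?\<beta> = "monomial_mor n g b b' d"
  fix k :: nat and t :: "'a \<times> nat \<times> 'c \<Rightarrow> 'b" and z :: "'d \<times> nat \<times> 'e"
  assume k: "k < n" and t: "t \<in> axis (\<lambda>k. f (g k)) (\<lambda>k. (a (g k), g k, b k)) (f (g k)) k"
  obtain x j y where z: "z = (x, j, y)"
    by (cases z)
  have gk: "g k < n" "f (g k) < n"
    using A B k by (auto simp: monomial_def)
  \<comment> \<open>\<open>hcomp\<close> applies \<open>\<beta>\<close> to the slices of
    \<open>t\<close> in the last coordinate. Each slice lies in the entry of \<open>B\<close>, so
    the normalisation of \<open>\<beta>\<close> does not replace it by 0.\<close>
  have row: "(\<lambda>y'. t (x', j, y')) \<in> axis g b j k" for x' j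
    using t by (auto simp: axis_def)
  have \<beta>: "?\<beta> j k (\<lambda>y'. t (x', j, y')) y = (if j = g k \<and> y = b' k then d k * t (x', j, b k) else 0)"
    for x' using row[of x' j] k gk by (auto simp: monomial_mor_def)
  show "(case z of (x, j, y) \<Rightarrow> ?\<alpha> (f (g k)) j (\<lambda>x'. ?\<beta> j k (\<lambda>y'. t (x', j, y')) y) x) =
      (if z = (a' (g k), g k, b' k) then c (g k) * d k * t (a (g k), g k, b k) else 0)"
  proof (cases "j = g k \<and> y = b' k")
    case True
    then have "(\<lambda>x'. d k * t (x', j, b k)) \<in> axis f a (f (g k)) j"
      using t by (auto simp: axis_def)
    then have "?\<alpha> (f (g k)) j (\<lambda>x'. d k * t (x', j, b k)) x =
        (if x = a' (g k) then c (g k) * d k * t (a (g k), g k, b k) else 0)"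
      using True gk k by (simp add: monomial_mor_def)
    moreover have "(\<lambda>x'. ?\<beta> j k (\<lambda>y'. t (x', j, y')) y) = (\<lambda>x'. d k * t (x', j, b k))"
      unfolding \<beta> using True by simp
    ultimately show ?thesis
      using True by (simp add: z)
  next
    case False
    have "(\<lambda>x'. ?\<beta> j k (\<lambda>y'. t (x', j, y')) y) = (\<lambda>_. 0)"
      unfolding \<beta> using False by auto
    then show ?thesis
      using False by (auto simp: z)
  qed
next
  fix i k
  have row: "(\<lambda>y'. (0 :: 'a \<times> nat \<times> 'c \<Rightarrow> 'b) (x', j, y')) = (\<lambda>_. 0)" for x' j
    by simp
  show "(\<lambda>(x, j, y). monomial_mor n f a a' c i j (\<lambda>x'.
      monomial_mor n g b b' d j k (\<lambda>y'. (0 :: 'a \<times> nat \<times> 'c \<Rightarrow> 'b) (x', j, y')) y) x) = 0"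
    unfolding row by (simp add: fun_eq_iff)
qed

lemma assoc_monomial:
  assumes "monomial n f a A" "monomial n g b B" "monomial n h c C"
  shows "assoc A B C = monomial_mor n (\<lambda>k. f (g (h k)))
    (\<lambda>k. ((a (g (h k)), g (h k), b (h k)), h k, c k))
    (\<lambda>k. (a (g (h k)), g (h k), (b (h k), h k, c k))) (\<lambda>_. 1)"
  unfolding assoc_def
proof (rule restr2_eq_monomial_mor[OF monomial_comp1[OF monomial_comp1[OF assms(1,2)] assms(3)]])
  let ?s = "\<lambda>k. ((a (g (h k)), g (h k), b (h k)), h k, c k)"
  fix k :: nat and t :: "('a \<times> nat \<times> 'c) \<times> nat \<times> 'd \<Rightarrow> 'b" and w :: "'a \<times> nat \<times> ('c \<times> nat \<times> 'd)"
  assume t: "t \<in> axis (\<lambda>k. f (g (h k))) ?s (f (g (h k))) k"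
  obtain x j y l z where w: "w = (x, j, (y, l, z))"
    by (cases w) auto
  have "t ((x, j, y), l, z) = 0" if "((x, j, y), l, z) \<noteq> ?s k"
    using t that unfolding axis_def by blast
  then show "(case w of (x, j, y, k, z) \<Rightarrow> t ((x, j, y), k, z)) =
      (if w = (a (g (h k)), g (h k), (b (h k), h k, c k)) then 1 * t (?s k) else 0)"
    unfolding w by auto
qed (simp add: fun_eq_iff)

lemma lunit_monomial:
  assumes "monomial n f a B"
  shows "lunit B = monomial_mor n f (\<lambda>k. ((), f k, a k)) a (\<lambda>_. 1)"
proof -
  have "tgt B = n"
    using assms by (simp add: monomial_def)
  then show ?thesis
    unfolding lunit_def
    by (intro restr2_eq_monomial_mor)
      (use monomial_comp1[OF monomial_one1 assms] in \<open>auto simp: axis_def fun_eq_iff\<close>)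
qed

lemma lunit_inv_monomial:
  assumes "monomial n f a B"
  shows "lunit_inv B = monomial_mor n f a (\<lambda>k. ((), f k, a k)) (\<lambda>_. 1)"
  unfolding lunit_inv_def
  by (rule restr2_eq_monomial_mor[OF assms]) (auto simp: axis_def pure_def fun_eq_iff one_fun_def split: if_splits)

lemma runit_monomial:
  assumes "monomial n f a A"
  shows "runit A = monomial_mor n f (\<lambda>k. (a k, k, ())) a (\<lambda>_. 1)"
proof -
  have "src A = n"
    using assms by (simp add: monomial_def)
  then show ?thesis
    unfolding runit_def
    by (intro restr2_eq_monomial_mor)
      (use monomial_comp1[OF assms monomial_one1] in \<open>auto simp: axis_def fun_eq_iff\<close>)
qed


section \<open>Coefficients as linear coordinates on 2-morphisms\<close>

lemma monomial_mor_add: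
  "monomial_mor n f a b c + monomial_mor n f a b d = monomial_mor n f a b (\<lambda>k. c k + d k)"
  by (auto simp: monomial_mor_def fun_eq_iff algebra_simps)

lemma mscale_monomial_mor:
  "mscale r (monomial_mor n f a b c) = monomial_mor n f a b (\<lambda>k. r * c k)"
  by (auto simp: monomial_mor_def mscale_def fscale_def fun_eq_iff)

text \<open>Evaluation at the basis vector of column \<open>k\<close> recovers the coefficient, so
  coefficients are well-defined coordinates; linear independence below rests on this.\<close>

lemma monomial_mor_coeff:
  "k < n \<Longrightarrow> f k < n \<Longrightarrow> monomial_mor n f a b c (f k) k (\<lambda>x. if x = a k then 1 else 0) (b k) = c k"
  by (auto simp: monomial_mor_def axis_def)

lemma monomial_mor_inject:
  assumes "monomial_mor n f a b c = monomial_mor n f a b d" "k < n" "f k < n"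
  shows "c k = d k"
  using monomial_mor_coeff[of k n f a b c] monomial_mor_coeff[of k n f a b d] assms by simp


section \<open>The 2-representation of a \<open>G\<close>-set\<close>

locale gset = group G for G (structure) +
  fixes S :: "('a, 's) gset"
  assumes act_closed: "g \<in> carrier G \<Longrightarrow> s \<in> fst S \<Longrightarrow> snd S g s \<in> fst S"
    and act_one: "s \<in> fst S \<Longrightarrow> snd S \<one> s = s"
    and act_mult: "g \<in> carrier G \<Longrightarrow> h \<in> carrier G \<Longrightarrow> s \<in> fst S \<Longrightarrow>
      snd S (g \<otimes> h) s = snd S g (snd S h s)"

definition common_fixpoints :: "('g, 's) gset \<Rightarrow> 'g \<Rightarrow> 'g \<Rightarrow> 's set"
  where "common_fixpoints S g h = {s \<in> fst S. snd S g s = s \<and> snd S h s = s}"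

locale ordered_gset = gset +
  fixes xs :: "'s list"
  assumes distinct: "distinct xs" and set_xs: "set xs = fst S"
begin

abbreviation "n \<equiv> length xs"

lemma nth_in_gset: "j < n \<Longrightarrow> xs ! j \<in> fst S"
  using set_xs nth_mem by blast

text \<open>The action carried over to positions along the ordering; it is the support function of
  \<open>\<rho>_g\<close> as a monomial 2-matrix.\<close>

definition idx :: "'a \<Rightarrow> nat \<Rightarrow> nat"
  where "idx g j = (SOME i. i < n \<and> xs ! i = snd S g (xs ! j))"

lemma idx:
  assumes "g \<in> carrier G" "j < n"
  shows "idx g j < n" "xs ! idx g j = snd S g (xs ! j)"
proof -
  have "snd S g (xs ! j) \<in> set xs"
    using assms act_closed set_xs nth_mem by blast
  then have "\<exists>i. i < n \<and> xs ! i = snd S g (xs ! j)"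
    by (auto simp: in_set_conv_nth)
  then have "idx g j < n \<and> xs ! idx g j = snd S g (xs ! j)"
    unfolding idx_def by (rule someI_ex)
  then show "idx g j < n" "xs ! idx g j = snd S g (xs ! j)"
    by blast+
qed

lemma nth_eq_act_iff:
  assumes "g \<in> carrier G" "i < n" "j < n"
  shows "xs ! i = snd S g (xs ! j) \<longleftrightarrow> i = idx g j"
  using idx[OF assms(1,3)] assms(2) distinct by (metis nth_eq_iff_index_eq)

lemma idx_one: "j < n \<Longrightarrow> idx \<one> j = j"
  using nth_eq_act_iff[of \<one> j j] act_one[OF nth_in_gset] by simp

lemma idx_mult:
  assumes "g \<in> carrier G" "h \<in> carrier G" "j < n"
  shows "idx (g \<otimes> h) j = idx g (idx h j)"
proof -
  have "xs ! idx g (idx h j) = snd S (g \<otimes> h) (xs ! j)"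
    using idx assms act_mult[OF assms(1,2) nth_in_gset[OF assms(3)]] by simp
  then show ?thesis
    using nth_eq_act_iff[of "g \<otimes> h" "idx g (idx h j)" j] assms idx by simp
qed

lemma idx_inv:
  assumes "g \<in> carrier G" "j < n"
  shows "idx g (idx (inv g) j) = j" "idx (inv g) (idx g j) = j"
  using idx_mult[of g "inv g" j] idx_mult[of "inv g" g j] idx_one assms by simp_all

section \<open>Monomial form of the 2-representation of an ordered G-set\<close>

lemma monomial_perm_mat2:
  assumes "g \<in> carrier G"
  shows "monomial n (idx g) (\<lambda>_. ()) (perm_mat2 S xs g :: (unit, 'k::field) mat2)"
proof -
  have "(if xs ! i = snd S g (xs ! k) then UNIV else {0}) =
      (axis (idx g) (\<lambda>_. ()) i k :: (unit \<Rightarrow> 'k) set)" if "i < n" "k < n" for i k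
    using nth_eq_act_iff[OF assms that] by (auto simp: axis_def fun_eq_iff)
  then show ?thesis
    using idx assms by (simp add: monomial_def perm_mat2_def)
qed

lemma phi_gset_rep2:
  assumes "g \<in> carrier G" "h \<in> carrier G"
  shows "phi (gset_rep2 G S xs) g h = (monomial_mor n (\<lambda>k. idx g (idx h k)) (\<lambda>k. ((), idx h k, ()))
    (\<lambda>_. ()) (\<lambda>_. 1) :: (_, _, 'k::field) mor2)"
proof -
  have "restr2 (perm_mat2 S xs g \<bullet> perm_mat2 S xs h) (\<lambda>_ _ t _. \<Sum>j<n. t ((), j, ())) =
    (monomial_mor n (\<lambda>k. idx g (idx h k)) (\<lambda>k. ((), idx h k, ()))
    (\<lambda>_. ()) (\<lambda>_. 1) :: (_, _, 'k::field) mor2)"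
  proof (rule restr2_eq_monomial_mor[OF monomial_comp1[OF monomial_perm_mat2 monomial_perm_mat2]])
    fix k y and t :: "unit \<times> nat \<times> unit \<Rightarrow> 'k"
    assume k: "k < n"
      and t: "t \<in> axis (\<lambda>k. idx g (idx h k)) (\<lambda>k. ((), idx h k, ())) (idx g (idx h k)) k"
    \<comment> \<open>A tensor in column \<open>k\<close> lives in the single summand
      \<open>j = idx h k\<close>, so the sum over all summands just reads off its
      coordinate.\<close>
    have "(\<Sum>j<n. t ((), j, ())) = (\<Sum>j<n. if j = idx h k then t ((), idx h k, ()) else 0)"
      using t by (intro sum.cong) (auto simp: axis_def)
    then show "(\<Sum>j<n. t ((), j, ())) = (if y = () then 1 * t ((), idx h k, ()) else 0)"
      using idx[OF assms(2) k] by simp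
  qed (use assms in \<open>auto simp: fun_eq_iff\<close>)
  then show ?thesis
    by (simp add: gset_rep2_def)
qed

lemma deg_gset_rep2: "deg (gset_rep2 G S xs) = n"
  and rho_gset_rep2: "rho (gset_rep2 G S xs) = perm_mat2 S xs"
  by (simp_all add: gset_rep2_def)

lemma phi1_gset_rep2:
  "phi1 (gset_rep2 G S xs) = monomial_mor n (idx \<one>) (\<lambda>_. ()) (\<lambda>_. ()) (\<lambda>_. 1)"
  using id2_monomial[OF monomial_perm_mat2[OF one_closed]] by (simp add: gset_rep2_def)

text \<open>In monomial form every map involved has all coefficients 1, so each coherence equation
  only compares supports and follows from \<open>idx_mult\<close> and
  \<open>idx_one\<close>.\<close>

lemma is_rep2_gset_rep2: "is_rep2 G (gset_rep2 G S xs :: ('a, unit, 'k::field) rep2)"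
  unfolding is_rep2_def deg_gset_rep2 rho_gset_rep2
proof (intro conjI ballI)
  let ?R = "gset_rep2 G S xs :: ('a, unit, 'k) rep2"
  let ?P = "perm_mat2 S xs :: 'a \<Rightarrow> (unit, 'k) mat2"
  fix g h l
  assume g: "g \<in> carrier G" and h: "h \<in> carrier G" and l: "l \<in> carrier G"
  note Pg = monomial_perm_mat2[OF g, where 'k = 'k] and Ph = monomial_perm_mat2[OF h, where 'k = 'k]
    and Pl = monomial_perm_mat2[OF l, where 'k = 'k]
  \<comment> \<open>Both sides of the associativity condition are brought to one normal form on the
    source \<open>(\<rho>_g \<rho>_h) \<rho>_l\<close>.\<close>
  have "phi ?R (g \<otimes> h) l \<cdot> rwhisk (?P g \<bullet> ?P h) (?P l) (phi ?R g h) =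
      monomial_mor n (\<lambda>k. idx g (idx h (idx l k))) (\<lambda>k. (((), idx h (idx l k), ()), idx l k, ()))
        (\<lambda>_. ()) (\<lambda>_. 1)"
    unfolding phi_gset_rep2[OF g h] phi_gset_rep2[OF m_closed[OF g h] l] id2_monomial[OF Pl]
      hcomp_monomial_mor[OF monomial_comp1[OF Pg Ph] Pl]
    using idx[OF l] by (subst vcomp_monomial_mor) (auto simp: idx_mult[OF g h])
  moreover have "phi ?R g (h \<otimes> l) \<cdot> lwhisk (?P g) (?P h \<bullet> ?P l) (phi ?R h l) \<cdot>
      assoc (?P g) (?P h) (?P l) =
      monomial_mor n (\<lambda>k. idx g (idx h (idx l k))) (\<lambda>k. (((), idx h (idx l k), ()), idx l k, ()))
        (\<lambda>_. ()) (\<lambda>_. 1)"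
    unfolding phi_gset_rep2[OF h l] phi_gset_rep2[OF g m_closed[OF h l]] id2_monomial[OF Pg]
      hcomp_monomial_mor[OF Pg monomial_comp1[OF Ph Pl]] assoc_monomial[OF Pg Ph Pl]
    by (subst vcomp_monomial_mor, simp)+ (auto simp: idx_mult[OF h l])
  ultimately show "phi ?R (g \<otimes> h) l \<cdot> rwhisk (?P g \<bullet> ?P h) (?P l) (phi ?R g h) =
      phi ?R g (h \<otimes> l) \<cdot> lwhisk (?P g) (?P h \<bullet> ?P l) (phi ?R h l) \<cdot> assoc (?P g) (?P h) (?P l)"
    by simp
next
  let ?R = "gset_rep2 G S xs :: ('a, unit, 'k) rep2"
  let ?P = "perm_mat2 S xs :: 'a \<Rightarrow> (unit, 'k) mat2"
  show "iso2 (?P \<one>) (one1 n) (phi1 ?R)"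
    unfolding phi1_gset_rep2
    by (rule monomial_mor_iso2[OF monomial_perm_mat2[OF one_closed] monomial_one1]) (simp add: idx_one)
  fix g
  assume g: "g \<in> carrier G"
  note Pg = monomial_perm_mat2[OF g, where 'k = 'k]
    and P1 = monomial_perm_mat2[OF one_closed, where 'k = 'k]
  show "?P g \<in> hom1 n n"
    using Pg by (rule monomial_hom1)
  show "iso2 (?P g \<bullet> ?P h) (?P (g \<otimes> h)) (phi ?R g h)" if h: "h \<in> carrier G" for h
    unfolding phi_gset_rep2[OF g h]
    by (rule monomial_mor_iso2[OF monomial_comp1[OF Pg monomial_perm_mat2[OF h]]
          monomial_perm_mat2[OF m_closed[OF g h]]])
      (simp add: idx_mult g h)
  show "phi ?R \<one> g = lunit (?P g) \<cdot> rwhisk (?P \<one>) (?P g) (phi1 ?R)"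
    unfolding phi_gset_rep2[OF one_closed g] phi1_gset_rep2 lunit_monomial[OF Pg] id2_monomial[OF Pg]
      hcomp_monomial_mor[OF P1 Pg]
    using idx[OF g] by (subst vcomp_monomial_mor) (auto simp: idx_one)
  show "phi ?R g \<one> = runit (?P g) \<cdot> lwhisk (?P g) (?P \<one>) (phi1 ?R)"
    unfolding phi_gset_rep2[OF g one_closed] phi1_gset_rep2 runit_monomial[OF Pg] id2_monomial[OF Pg]
      hcomp_monomial_mor[OF Pg P1]
    by (subst vcomp_monomial_mor) (auto simp: idx_one)
qed

section \<open>The conjugation maps on the categorical trace and the 2-character\<close>

abbreviation diag_mor :: "(nat \<Rightarrow> 'k::field) \<Rightarrow> (unit, unit, 'k) mor2"
  where "diag_mor \<equiv> monomial_mor n (\<lambda>k. k) (\<lambda>_. ()) (\<lambda>_. ())"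

text \<open>Right whiskering by \<open>\<rho>\<close> of \<open>inv g\<close> makes the given
  2-morphism act in column \<open>idx (inv g) k\<close>; all other factors have coefficient 1. The
  hypothesis on \<open>c\<close> makes the supports match where the coefficient is nonzero, since
  there \<open>idx h\<close> fixes \<open>idx (inv g) k\<close>.\<close>

lemma conj2_diag_mor:
  fixes c :: "nat \<Rightarrow> 'k::field"
  assumes g: "g \<in> carrier G" and h: "h \<in> carrier G"
    and c: "\<And>k. k < n \<Longrightarrow> c k \<noteq> 0 \<Longrightarrow> idx h k = k"
  shows "conj2 G (gset_rep2 G S xs) g h (diag_mor c) = diag_mor (\<lambda>k. c (idx (inv g) k))"
proof -
  have g': "inv g \<in> carrier G" using g by simp
  note P = monomial_perm_mat2[where 'k = 'k]
  note Pg = P[OF g] and Ph = P[OF h] and Pg' = P[OF g'] and P1 = P[OF one_closed]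
  have inv_phi: "inv2 (perm_mat2 S xs g \<bullet> perm_mat2 S xs (inv g)) (perm_mat2 S xs (g \<otimes> inv g))
      (phi (gset_rep2 G S xs) g (inv g)) =
      (monomial_mor n (idx (g \<otimes> inv g)) (\<lambda>_. ()) (\<lambda>k. ((), idx (inv g) k, ())) (\<lambda>_. 1)
        :: (_, _, 'k) mor2)"
    unfolding phi_gset_rep2[OF g g']
    by (rule inv2_monomial_mor[OF monomial_comp1[OF Pg Pg'] P[OF m_closed[OF g g']]])
      (simp add: idx_mult[OF g g'])
  have inv_phi1: "inv2 (perm_mat2 S xs \<one>) (one1 n) (phi1 (gset_rep2 G S xs)) =
      (diag_mor (\<lambda>_. 1) :: (_, _, 'k) mor2)"
    unfolding phi1_gset_rep2
    by (rule inv2_monomial_mor[OF P1 monomial_one1]) (simp add: idx_one)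
  have idx': "k < n \<Longrightarrow> idx g (idx (inv g) k) = k" "k < n \<Longrightarrow> idx (g \<otimes> inv g) k = k"
    "k < n \<Longrightarrow> idx (inv g) k < n" for k
    using g by (simp_all add: idx_inv idx idx_one)
  show ?thesis
    unfolding conj2_def Let_def deg_gset_rep2 rho_gset_rep2 inv_phi inv_phi1
      phi_gset_rep2[OF g m_closed[OF h g']] phi_gset_rep2[OF h g']
      lunit_inv_monomial[OF Pg'] id2_monomial[OF Pg] id2_monomial[OF Pg']
      hcomp_monomial_mor[OF monomial_one1 Pg']
      hcomp_monomial_mor[OF Pg monomial_comp1[OF Ph Pg']]
      hcomp_monomial_mor[OF Pg monomial_comp1[OF monomial_one1 Pg']]
      hcomp_monomial_mor[OF Pg Pg']
    using idx' c by ((subst vcomp_monomial_mor, force simp: idx_mult[OF h g'])+) simp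
qed


text \<open>A 2-morphism out of the identity is given by one vector in each diagonal entry, and the
  diagonal entry of \<open>\<rho>_h\<close> at \<open>k\<close> is nonzero exactly when
  \<open>h\<close> fixes the point at \<open>k\<close>.\<close>

lemma cat_trace_perm_mat2:
  assumes h: "h \<in> carrier G"
  shows "cat_trace (perm_mat2 S xs h) =
    {diag_mor c | c :: nat \<Rightarrow> 'k::field. \<forall>k<n. c k \<noteq> 0 \<longrightarrow> idx h k = k}" (is "_ = ?D")
proof
  have Ph: "monomial n (idx h) (\<lambda>_. ()) (perm_mat2 S xs h :: (unit, 'k) mat2)"
    by (rule monomial_perm_mat2[OF h])
  then have src: "src (perm_mat2 S xs h :: (unit, 'k) mat2) = n"
    by (simp add: monomial_def)
  show "?D \<subseteq> cat_trace (perm_mat2 S xs h)"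
    unfolding cat_trace_def src
    by (auto intro!: monomial_mor_hom2[OF monomial_one1 Ph])
  show "cat_trace (perm_mat2 S xs h) \<subseteq> ?D"
  proof
    fix \<phi> :: "(unit, unit, 'k) mor2"
    assume "\<phi> \<in> cat_trace (perm_mat2 S xs h)"
    then have \<phi>: "\<phi> \<in> hom2 (one1 n) (perm_mat2 S xs h)"
      by (simp add: cat_trace_def src)
    \<comment> \<open>The constant function 1 generates the ground field
      \<open>unit \<Rightarrow> 'k\<close>; its image under each diagonal component is the
      coordinate.\<close>
    define c where "c k = \<phi> k k (\<lambda>_. 1) ()" for k
    have lin: "linear_map UNIV (ent (perm_mat2 S xs h) k k) (\<phi> k k)" if "k < n" for k
    proof -
      have "\<forall>i<n. \<forall>j<n. linear_map (if i = j then UNIV else {0}) (ent (perm_mat2 S xs h) i j) (\<phi> i j)"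
        using \<phi> by (simp add: hom2_def one1_def)
      from this[rule_format, OF that that] show ?thesis
        by simp
    qed
    have "idx h k = k" if k: "k < n" and "c k \<noteq> 0" for k
    proof (rule ccontr)
      assume "idx h k \<noteq> k"
      then have "\<phi> k k (\<lambda>_. 1) \<in> {0}"
        using lin[OF k] nth_eq_act_iff[OF h k k] by (auto simp: linear_map_def perm_mat2_def)
      then show False
        using that by (simp add: c_def)
    qed
    moreover have "restr2 (one1 n) \<phi> = diag_mor c"
    proof (rule restr2_eq_monomial_mor[OF monomial_one1])
      fix k y and t :: "unit \<Rightarrow> 'k"
      assume k: "k < n"
      have "t = fscale (t ()) (\<lambda>_. 1)"
        by (simp add: fscale_def fun_eq_iff)
      then have "\<phi> k k t = fscale (t ()) (\<phi> k k (\<lambda>_. 1))"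
        using lin[OF k] unfolding linear_map_def by (metis UNIV_I)
      then show "\<phi> k k t y = (if y = () then c k * t () else 0)"
        by (simp add: fscale_def c_def)
    qed (use hom2_zero[OF \<phi>] in simp)
    moreover have "restr2 (one1 n) \<phi> = \<phi>"
      using \<phi> by (simp add: hom2_def)
    ultimately show "\<phi> \<in> ?D"
      by auto
  qed
qed

text \<open>Expansion in the future basis of the categorical trace. The empty sum also identifies
  the zero 2-morphism with the zero coefficients.\<close>

lemma diag_mor_sum:
  assumes "finite F"
  shows "(\<Sum>i\<in>F. mscale (r i) (diag_mor (\<lambda>k. if k = i then 1 else 0))) =
    diag_mor (\<lambda>k. if k \<in> F then r k else 0)"
  using assms
proof (induction F)
  case empty
  show ?case
    by (auto simp: monomial_mor_def fun_eq_iff)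
next
  case (insert x F)
  then show ?case
    by (simp add: mscale_monomial_mor monomial_mor_add) (auto intro!: monomial_mor_cong)
qed

theorem character2_gset_rep2:
  assumes g: "g \<in> carrier G" and h: "h \<in> carrier G" and comm: "g \<otimes> h = h \<otimes> g"
  shows "character2 G (gset_rep2 G S xs :: ('a, unit, 'k::field) rep2) g h =
    of_nat (card (common_fixpoints S g h))"
proof -
  \<comment> \<open>The positions fixed by \<open>h\<close> index the basis \<open>\<delta>\<close>
    of the categorical trace.\<close>
  define F where "F = {k. k < n \<and> idx h k = k}"
  define \<delta> :: "nat \<Rightarrow> (unit, unit, 'k) mor2"
    where "\<delta> i = diag_mor (\<lambda>k. if k = i then 1 else 0)" for i
  let ?T = "conj2 G (gset_rep2 G S xs) g h :: (unit, unit, 'k) mor2 \<Rightarrow> _"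
  let ?V = "cat_trace (perm_mat2 S xs h) :: (unit, unit, 'k) mor2 set"
  have g': "inv g \<in> carrier G" using g by simp
  have F: "finite F" "\<And>i. i \<in> F \<Longrightarrow> i < n"
    by (auto simp: F_def)
  have V_I: "diag_mor c \<in> ?V" if "\<forall>k<n. c k \<noteq> 0 \<longrightarrow> idx h k = k" for c
    unfolding cat_trace_perm_mat2[OF h] using that by blast
  have V_E: thesis
    if "v \<in> ?V" "\<And>c. v = diag_mor c \<Longrightarrow> \<forall>k<n. c k \<noteq> 0 \<longrightarrow> idx h k = k \<Longrightarrow> thesis" for v thesis
    using that(1) unfolding cat_trace_perm_mat2[OF h] by (elim CollectE exE conjE) (rule that(2))
  have T: "?T (diag_mor c) = diag_mor (\<lambda>k. c (idx (inv g) k))"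
    if "\<forall>k<n. c k \<noteq> 0 \<longrightarrow> idx h k = k" for c
    using that by (intro conj2_diag_mor[OF g h]) auto
  have idx_comm: "idx g (idx h k) = idx h (idx g k)" if "k < n" for k
    using idx_mult[OF g h that] idx_mult[OF h g that] comm by simp
  \<comment> \<open>Commutativity enters here: if \<open>h\<close> fixes the translate of
    \<open>k\<close> by \<open>inv g\<close>, it fixes \<open>k\<close>. Hence the conjugation map
    preserves the categorical trace of \<open>\<rho>_h\<close>.\<close>
  have idx_comm': "idx h k = k" if k: "k < n" and eq: "idx h (idx (inv g) k) = idx (inv g) k" for k
    using idx_comm[of "idx (inv g) k"] idx[OF g' k] idx_inv[OF g k] eq by simp
  have \<delta>_eq_iff: "\<delta> i = \<delta> j \<longleftrightarrow> i = j" if "i < n" for i j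
  proof
    assume "\<delta> i = \<delta> j"
    from monomial_mor_inject[OF this[unfolded \<delta>_def] that that] show "i = j"
      by (simp split: if_splits)
  qed simp
  then have inj: "inj_on \<delta> F"
    using F by (auto intro: inj_onI)
  have sum\<delta>: "(\<Sum>i\<in>F. mscale (r i) (\<delta> i)) = diag_mor (\<lambda>k. if k \<in> F then r k else 0)" for r
    unfolding \<delta>_def by (rule diag_mor_sum[OF F(1)])
  have fin: "finite (\<delta> ` F)"
    using F by simp
  \<comment> \<open>A vanishing combination of the \<open>\<delta> i\<close> is a
    \<open>diag_mor\<close> equal to the zero one, so its coefficients can be compared one by
    one.\<close>
  have zero: "\<forall>x\<in>\<delta> ` F. r x = 0" if "(\<Sum>x\<in>\<delta> ` F. mscale (r x) x) = 0" for r
  proof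
    fix x
    assume "x \<in> \<delta> ` F"
    then obtain i where i: "i \<in> F" "x = \<delta> i" by blast
    have "diag_mor (\<lambda>k. if k \<in> F then r (\<delta> k) else 0) = diag_mor (\<lambda>k. 0)"
      using that sum\<delta>[of "\<lambda>k. r (\<delta> k)"] diag_mor_sum[of "{}"]
      by (simp add: sum.reindex[OF inj])
    from monomial_mor_inject[OF this F(2)[OF i(1)] F(2)[OF i(1)]]
    show "r x = 0"
      using i by simp
  qed
  have ind: "mor_space.independent (\<delta> ` F)"
    by (rule mor_space.independent_if_scalars_zero[OF fin]) (drule zero, auto)
  have span: "mor_space.span (\<delta> ` F) = ?V"
  proof (rule subset_antisym)
    have "mor_space.subspace ?V"
    proof (rule mor_space.subspaceI)
      have "0 = diag_mor (\<lambda>_. 0 :: 'k)"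
        using diag_mor_sum[of "{}"] by simp
      also have "\<dots> \<in> ?V"
        by (rule V_I) simp
      finally show "0 \<in> ?V" .
    next
      fix u v
      assume "u \<in> ?V" "v \<in> ?V"
      obtain c where c: "u = diag_mor c" "\<forall>k<n. c k \<noteq> 0 \<longrightarrow> idx h k = k"
        using \<open>u \<in> ?V\<close> by (rule V_E)
      obtain d where d: "v = diag_mor d" "\<forall>k<n. d k \<noteq> 0 \<longrightarrow> idx h k = k"
        using \<open>v \<in> ?V\<close> by (rule V_E)
      have "\<forall>k<n. c k + d k \<noteq> 0 \<longrightarrow> idx h k = k"
        using c d by (metis add.right_neutral)
      from V_I[OF this] show "u + v \<in> ?V"
        unfolding c(1) d(1) monomial_mor_add .
    next
      fix r u
      assume "u \<in> ?V"
      then obtain c where c: "u = diag_mor c" "\<forall>k<n. c k \<noteq> 0 \<longrightarrow> idx h k = k"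
        by (rule V_E)
      show "mscale r u \<in> ?V"
        unfolding c(1) mscale_monomial_mor using c(2) by (intro V_I) simp
    qed
    moreover have "\<delta> ` F \<subseteq> ?V"
      unfolding \<delta>_def by (auto intro!: V_I simp: F_def split: if_splits)
    ultimately show "mor_space.span (\<delta> ` F) \<subseteq> ?V"
      by (intro mor_space.span_minimal)
    show "?V \<subseteq> mor_space.span (\<delta> ` F)"
    proof
      fix v
      assume "v \<in> ?V"
      then obtain c where c: "v = diag_mor c" "\<forall>k<n. c k \<noteq> 0 \<longrightarrow> idx h k = k"
        by (rule V_E)
      have "v = (\<Sum>i\<in>F. mscale (c i) (\<delta> i))"
        unfolding sum\<delta> c(1) using c(2) by (intro monomial_mor_cong) (auto simp: F_def)
      also have "\<dots> \<in> mor_space.span (\<delta> ` F)"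
        by (intro mor_space.span_sum mor_space.span_scale mor_space.span_base) auto
      finally show "v \<in> mor_space.span (\<delta> ` F)" .
    qed
  qed
  have "character2 G (gset_rep2 G S xs) g h =
      (\<Sum>b\<in>\<delta> ` F. mor_space.representation (\<delta> ` F) (?T b) b)"
    unfolding character2_def rho_gset_rep2
  proof (rule mor_space.trace_on_basis[OF fin ind span])
    fix v
    assume "v \<in> ?V"
    then obtain c where v: "v = diag_mor c" and c: "\<forall>k<n. c k \<noteq> 0 \<longrightarrow> idx h k = k"
      by (rule V_E)
    have "\<forall>k<n. c (idx (inv g) k) \<noteq> 0 \<longrightarrow> idx h k = k"
      using c idx_comm' idx(1)[OF g'] by blast
    then show "?T v \<in> ?V"
      unfolding v T[OF c] by (rule V_I)
    show "?T (mscale r v) = mscale r (?T v)" for r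
      using T[of "\<lambda>k. r * c k"] c unfolding v T[OF c] mscale_monomial_mor by simp
    fix w
    assume "w \<in> ?V"
    then obtain d where w: "w = diag_mor d" and d: "\<forall>k<n. d k \<noteq> 0 \<longrightarrow> idx h k = k"
      by (rule V_E)
    have "\<forall>k<n. c k + d k \<noteq> 0 \<longrightarrow> idx h k = k"
      using c d by (metis add.right_neutral)
    from T[OF this] show "?T (v + w) = ?T v + ?T w"
      unfolding v w T[OF c] T[OF d] monomial_mor_add by simp
  qed
  also have "\<dots> = (\<Sum>i\<in>F. mor_space.representation (\<delta> ` F) (?T (\<delta> i)) (\<delta> i))"
    by (simp add: sum.reindex[OF inj])
  also have "\<dots> = (\<Sum>i\<in>F. if idx g i = i then 1 else 0)"
  proof (rule sum.cong[OF refl])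
    fix i
    assume i: "i \<in> F"
    then have i': "i < n" "idx h i = i"
      by (auto simp: F_def)
    have gi: "idx g i \<in> F"
      using idx_comm[OF i'(1)] idx(1)[OF g i'(1)] i' by (simp add: F_def)
    \<comment> \<open>The coefficient is 1 where \<open>inv g\<close> carries \<open>k\<close> to
      \<open>i\<close>, that is at \<open>k = idx g i\<close>: the basis vector at \<open>i\<close>
      moves to the one at \<open>idx g i\<close>, and it contributes 1 to the trace exactly when
      \<open>g\<close> fixes \<open>i\<close>.\<close>
    have "?T (\<delta> i) = diag_mor (\<lambda>k. if idx (inv g) k = i then 1 else 0)"
      unfolding \<delta>_def using i' by (subst T) auto
    also have "\<dots> = \<delta> (idx g i)"
      unfolding \<delta>_def using idx_inv[OF g] i' by (intro monomial_mor_cong) auto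
    finally have "?T (\<delta> i) = \<delta> (idx g i)" .
    then show "mor_space.representation (\<delta> ` F) (?T (\<delta> i)) (\<delta> i) = (if idx g i = i then 1 else 0)"
      using mor_space.representation_basis[OF ind, of "\<delta> (idx g i)"] gi \<delta>_eq_iff[OF i'(1)] by auto
  qed
  also have "\<dots> = of_nat (card {i \<in> F. idx g i = i})"
    using F(1) by (simp add: sum.If_cases Int_def)
  \<comment> \<open>From positions back to points: the ordering is injective because
    \<open>xs\<close> is distinct.\<close>
  also have "card {i \<in> F. idx g i = i} = card ((!) xs ` {i \<in> F. idx g i = i})"
    using distinct F by (intro card_image[symmetric]) (auto simp: inj_on_def nth_eq_iff_index_eq)
  also have "(!) xs ` {i \<in> F. idx g i = i} = common_fixpoints S g h"
  proof -
    have "snd S g' (xs ! i) = xs ! i \<longleftrightarrow> idx g' i = i" if "i < n" "g' \<in> carrier G" for g' i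
      using nth_eq_act_iff[OF that(2,1,1)] by auto
    then show ?thesis
      using g h unfolding common_fixpoints_def set_xs[symmetric] F_def by (auto simp: in_set_conv_nth)
  qed
  finally show ?thesis .
qed

end


section \<open>Supports of weakly invertible 2-matrices\<close>

text \<open>The Boolean support of a 2-matrix. It is invariant under 2-isomorphism and
  multiplicative under composition, so it can replace a count of dimensions.\<close>

definition nonzero_ent :: "('i, 'k::field) mat2 \<Rightarrow> nat \<Rightarrow> nat \<Rightarrow> bool"
  where "nonzero_ent A i k \<longleftrightarrow> (\<exists>v\<in>ent A i k. v \<noteq> 0)"

lemma nonzero_ent_one1: "nonzero_ent (one1 n :: (unit, 'k::field) mat2) i k \<longleftrightarrow> i = k"
proof -
  have "(\<lambda>_. 1 :: 'k) \<noteq> (0 :: unit \<Rightarrow> 'k)"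
    by (simp add: fun_eq_iff)
  then show ?thesis
    unfolding nonzero_ent_def one1_def by auto
qed

lemma pure_zero [simp]: "pure j 0 w = 0" "pure j v 0 = 0"
  by (auto simp: pure_def fun_eq_iff)

text \<open>No cancellation can occur: the summands are direct, and over a field the tensor product
  of nonzero vectors is nonzero.\<close>

lemma nonzero_ent_comp1:
  "nonzero_ent (A \<bullet> B) i k \<longleftrightarrow> (\<exists>j<src A. nonzero_ent A i j \<and> nonzero_ent B j k)"
proof
  let ?P = "{pure j v w | j v w. j < src A \<and> v \<in> ent A i j \<and> w \<in> ent B j k}"
  assume nz: "nonzero_ent (A \<bullet> B) i k"
  show "\<exists>j<src A. nonzero_ent A i j \<and> nonzero_ent B j k"
  proof (rule ccontr)
    assume "\<not> ?thesis"
    then have "pure j v w = 0" if "j < src A" "v \<in> ent A i j" "w \<in> ent B j k" for j v w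
      using that by (metis nonzero_ent_def pure_zero)
    then have "?P \<subseteq> {0}"
      by blast
    then have "fun_space.span ?P \<subseteq> fun_space.span {0}"
      by (rule fun_space.span_mono)
    then show False
      using nz by (auto simp: nonzero_ent_def comp1_def)
  qed
next
  assume "\<exists>j<src A. nonzero_ent A i j \<and> nonzero_ent B j k"
  then obtain j v w where j: "j < src A" and v: "v \<in> ent A i j" "v \<noteq> 0" and w: "w \<in> ent B j k" "w \<noteq> 0"
    by (auto simp: nonzero_ent_def)
  obtain x y where "v x \<noteq> 0" "w y \<noteq> 0"
    using v w by (auto simp: fun_eq_iff)
  then have "pure j v w (x, j, y) \<noteq> 0"
    by (simp add: pure_def)
  then have "pure j v w \<noteq> 0"
    by auto
  moreover have "pure j v w \<in> ent (A \<bullet> B) i k"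
    unfolding comp1_def using j v w by (auto intro: fun_space.span_base)
  ultimately show "nonzero_ent (A \<bullet> B) i k"
    by (auto simp: nonzero_ent_def)
qed

text \<open>If \<open>\<alpha>\<close> killed a nonzero \<open>v\<close>, then \<open>v\<close>
  would be the image of 0 under the left inverse \<open>\<beta>\<close>.\<close>

lemma split_mono_nonzero_ent:
  assumes "\<alpha> \<in> hom2 A B" "\<beta> \<in> hom2 B A" "\<beta> \<cdot> \<alpha> = id2 A" "i < tgt A" "j < src A" "nonzero_ent A i j"
  shows "nonzero_ent B i j"
proof -
  obtain v where v: "v \<in> ent A i j" "v \<noteq> 0"
    using assms by (auto simp: nonzero_ent_def)
  have "\<beta> i j (\<alpha> i j v) = id2 A i j v"
    using assms(3) by (auto simp: vcomp_def fun_eq_iff)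
  then have "\<beta> i j (\<alpha> i j v) = v"
    using v assms by (simp add: id2_def restr2_def)
  then have "\<alpha> i j v \<noteq> 0"
    using v hom2_zero[OF assms(2), of i j] by auto
  moreover have "\<alpha> i j v \<in> ent B i j"
    using assms v by (auto simp: hom2_def linear_map_def)
  ultimately show ?thesis
    by (auto simp: nonzero_ent_def)
qed

lemma iso2_nonzero_ent_iff:
  assumes "iso2 A B \<alpha>" "i < tgt A" "j < src A"
  shows "nonzero_ent A i j \<longleftrightarrow> nonzero_ent B i j"
proof -
  obtain \<beta> where \<alpha>: "\<alpha> \<in> hom2 A B" and \<beta>: "\<beta> \<in> hom2 B A" "\<beta> \<cdot> \<alpha> = id2 A" "\<alpha> \<cdot> \<beta> = id2 B"
    using assms(1) by (auto simp: iso2_def)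
  have "tgt B = tgt A" "src B = src A"
    using \<alpha> by (auto simp: hom2_def)
  then show ?thesis
    using split_mono_nonzero_ent[OF \<alpha> \<beta>(1,2)] split_mono_nonzero_ent[OF \<beta>(1) \<alpha> \<beta>(3)] assms by auto
qed

lemma weakly_invertible_column:
  fixes f :: "('i, 'k::field) mat2"
  assumes "weakly_invertible f" "k < src f"
  shows "\<exists>j<tgt f. \<forall>i<tgt f. nonzero_ent f i k \<longleftrightarrow> i = j"
proof -
  obtain h :: "('i, 'k) mat2" and \<eta> \<epsilon> where h: "h \<in> hom1 (tgt f) (src f)"
    and \<eta>: "iso2 (f \<bullet> h) (one1 (tgt f)) \<eta>" and \<epsilon>: "iso2 (h \<bullet> f) (one1 (src f)) \<epsilon>"
    using assms by (auto simp: weakly_invertible_def)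
  have dims: "src h = tgt f" "tgt h = src f"
    using h by (auto simp: hom1_def)
  have fh: "(\<exists>l<src f. nonzero_ent f i l \<and> nonzero_ent h l j) \<longleftrightarrow> i = j" if "i < tgt f" "j < tgt f" for i j
    using iso2_nonzero_ent_iff[OF \<eta>, of i j] that dims
    by (simp add: nonzero_ent_comp1 nonzero_ent_one1) (simp add: comp1_def)
  have hf: "(\<exists>l<tgt f. nonzero_ent h i l \<and> nonzero_ent f l j) \<longleftrightarrow> i = j" if "i < src f" "j < src f" for i j
    using iso2_nonzero_ent_iff[OF \<epsilon>, of i j] that dims
    by (simp add: nonzero_ent_comp1 nonzero_ent_one1) (simp add: comp1_def)
  \<comment> \<open>The diagonal entry of \<open>h \<bullet> f\<close> at \<open>k\<close> yields
    \<open>j\<close> with \<open>h\<close> nonzero at \<open>(k, j)\<close> and \<open>f\<close>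
    nonzero at \<open>(j, k)\<close>. If \<open>f\<close> is also nonzero at \<open>(i, k)\<close>,
    then \<open>f \<bullet> h\<close> is nonzero at \<open>(i, j)\<close>, which forces
    \<open>i = j\<close>.\<close>
  obtain j where j: "j < tgt f" "nonzero_ent h k j" "nonzero_ent f j k"
    using hf[OF assms(2) assms(2)] by auto
  then show ?thesis
    using fh assms(2) by blast
qed

text \<open>The column of \<open>f\<close> at the position of \<open>s\<close> has one nonzero row
  \<open>j\<close>. The 2-isomorphism \<open>\<psi> g\<close> equates supports of
  \<open>\<rho>'_g f\<close> and \<open>f \<rho>_g\<close>; in this column they lie in rows
  \<open>g j\<close> and \<open>j\<close>, so \<open>j\<close> is fixed by every
  \<open>g\<close>.\<close>

theorem equivalent2_gset_rep2_fixed_point: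
  fixes S :: "('g, 's) gset" and S' :: "('g, 't) gset"
  assumes "ordered_gset G S xs" "ordered_gset G S' xs'"
    and equiv: "equivalent2 TYPE('u) G (gset_rep2 G S xs :: ('g, unit, 'k::field) rep2) (gset_rep2 G S' xs')"
    and s: "s \<in> fst S" "\<And>g. g \<in> carrier G \<Longrightarrow> snd S g s = s"
  shows "\<exists>s'\<in>fst S'. \<forall>g\<in>carrier G. snd S' g s' = s'"
proof -
  interpret X: ordered_gset G S xs by fact
  interpret Y: ordered_gset G S' xs' by fact
  obtain f :: "('u, 'k) mat2" and \<psi> where f: "f \<in> hom1 (length xs) (length xs')" "weakly_invertible f"
    and \<psi>: "\<And>g. g \<in> carrier G \<Longrightarrow> iso2 (perm_mat2 S' xs' g \<bullet> f) (f \<bullet> perm_mat2 S xs g) (\<psi> g)"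
    using equiv unfolding equivalent2_def X.deg_gset_rep2 Y.deg_gset_rep2 X.rho_gset_rep2 Y.rho_gset_rep2
    by blast
  have dims: "src f = length xs" "tgt f = length xs'"
    using f by (auto simp: hom1_def)
  have one: "(\<lambda>_. 1 :: 'k) \<noteq> (0 :: unit \<Rightarrow> 'k)"
    by (simp add: fun_eq_iff)
  obtain k where k: "k < length xs" "xs ! k = s"
    using s X.set_xs by (metis in_set_conv_nth)
  obtain j where j: "j < length xs'" and col: "\<And>i. i < length xs' \<Longrightarrow> nonzero_ent f i k \<longleftrightarrow> i = j"
    using weakly_invertible_column[OF f(2), of k] k dims by auto
  have "Y.idx g j = j" if g: "g \<in> carrier G" for g
  proof -
    have perm: "nonzero_ent (perm_mat2 S xs g :: (unit, 'k) mat2) i l \<longleftrightarrow> i = X.idx g l"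
      if "i < length xs" "l < length xs" for i l
      using X.nth_eq_act_iff[OF g that] one by (auto simp: nonzero_ent_def perm_mat2_def)
    have perm': "nonzero_ent (perm_mat2 S' xs' g :: (unit, 'k) mat2) i l \<longleftrightarrow> i = Y.idx g l"
      if "i < length xs'" "l < length xs'" for i l
      using Y.nth_eq_act_iff[OF g that] one by (auto simp: nonzero_ent_def perm_mat2_def)
    have gk: "X.idx g k = k"
      using X.nth_eq_act_iff[OF g k(1) k(1)] k s g by simp
    let ?i = "Y.idx g j"
    have i: "?i < length xs'"
      using Y.idx[OF g j] by simp
    \<comment> \<open>The path \<open>k\<close>, \<open>j\<close>, \<open>g j\<close> gives a
      nonzero entry on one side; on the other side column \<open>k\<close> of
      \<open>\<rho>_g\<close> returns to row \<open>k\<close>, so \<open>f\<close> itself is nonzero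
      at \<open>(g j, k)\<close>.\<close>
    have "nonzero_ent (perm_mat2 S' xs' g \<bullet> f) ?i k"
      unfolding nonzero_ent_comp1 using perm'[OF i j] col[OF j] j by (auto simp: perm_mat2_def)
    then have "nonzero_ent (f \<bullet> perm_mat2 S xs g) ?i k"
      using iso2_nonzero_ent_iff[OF \<psi>[OF g], of ?i k] i k dims by (simp add: comp1_def perm_mat2_def)
    then have "nonzero_ent f ?i k"
      unfolding nonzero_ent_comp1 using perm k gk dims by auto
    then show ?thesis
      using col[OF i] by simp
  qed
  then have "snd S' g (xs' ! j) = xs' ! j" if "g \<in> carrier G" for g
    using Y.idx(2)[OF that j] that by simp
  then show ?thesis
    using Y.nth_in_gset[OF j] by blast
qed


section \<open>Sums of \<open>G\<close>-sets and coset spaces\<close>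

lemma gset_gset_sum:
  assumes "gset G S" "gset G T"
  shows "gset G (S \<squnion> T)"
proof -
  interpret S: gset G S by fact
  interpret T: gset G T by fact
  show ?thesis
    by unfold_locales
      (auto simp: gset_sum_def S.act_closed S.act_one S.act_mult T.act_closed T.act_one T.act_mult)
qed

lemma common_fixpoints_gset_sum:
  "common_fixpoints (S \<squnion> T) g h = common_fixpoints S g h <+> common_fixpoints T g h"
  by (auto simp: common_fixpoints_def gset_sum_def)

lemma (in group) gset_regular_gset: "gset G (regular_gset G)"
  by unfold_locales (auto simp: regular_gset_def m_assoc)

lemma (in group) gset_point_gset: "gset G point_gset"
  by unfold_locales (auto simp: point_gset_def)

lemma (in group) gset_coset_gset:
  assumes "H \<subseteq> carrier G"
  shows "gset G (coset_gset G H)"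
proof -
  have closed: "g <# C \<in> lcosets H" if "g \<in> carrier G" "C \<in> lcosets H" for g C
    using that assms by (auto simp: LCOSETS_def lcos_m_assoc)
  have sub: "C \<subseteq> carrier G" if "C \<in> lcosets H" for C
    using that assms l_coset_subset_G by (auto simp: LCOSETS_def)
  show ?thesis
    by unfold_locales (auto simp: coset_gset_def closed sub lcos_mult_one lcos_m_assoc)
qed

text \<open>A \<open>G\<close>-equivariant map \<open>\<pi>\<close> from the regular \<open>G\<close>-set identifies its image with the cosets of the
  stabiliser of \<open>\<pi> \<one>\<close>.\<close>

locale equivariant_label = group G for G (structure) +
  fixes \<pi> :: "'a \<Rightarrow> 'l" and act :: "'a \<Rightarrow> 'l \<Rightarrow> 'l"
  assumes equivariant: "g \<in> carrier G \<Longrightarrow> x \<in> carrier G \<Longrightarrow> \<pi> (g \<otimes> x) = act g (\<pi> x)"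
begin

definition stab :: "'a set"
  where "stab = {x \<in> carrier G. \<pi> x = \<pi> \<one>}"

definition fibre :: "'l \<Rightarrow> 'a set"
  where "fibre l = {x \<in> carrier G. \<pi> x = l}"

text \<open>By equivariance, the label of a product depends only on the left factor and the label of
  the right one, so \<open>y\<close> may be replaced by \<open>x\<close> under multiplication by
  \<open>inv x\<close>.\<close>

lemma label_inv_mult:
  assumes "x \<in> carrier G" "y \<in> carrier G" "\<pi> y = \<pi> x"
  shows "\<pi> (inv x \<otimes> y) = \<pi> \<one>"
  using equivariant[of "inv x" y] equivariant[of "inv x" x] assms by simp

lemma subgroup_stab: "subgroup stab G"
proof
  fix x y
  assume "x \<in> stab" "y \<in> stab"
  then show "x \<otimes> y \<in> stab"
    using equivariant[of x y] equivariant[of x \<one>] by (simp add: stab_def)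
next
  fix x
  assume "x \<in> stab"
  then show "inv x \<in> stab"
    using label_inv_mult[of x \<one>] by (simp add: stab_def)
qed (auto simp: stab_def)

lemma l_coset_stab:
  assumes "x \<in> carrier G"
  shows "x <# stab = fibre (\<pi> x)"
proof
  show "x <# stab \<subseteq> fibre (\<pi> x)"
    using assms equivariant[of x] equivariant[of x \<one>] by (auto simp: l_coset_def stab_def fibre_def)
  show "fibre (\<pi> x) \<subseteq> x <# stab"
  proof
    fix y
    assume y: "y \<in> fibre (\<pi> x)"
    then have "inv x \<otimes> y \<in> stab" "y = x \<otimes> (inv x \<otimes> y)"
      using assms label_inv_mult[of x y] by (auto simp: fibre_def stab_def m_assoc[symmetric])
    then show "y \<in> x <# stab"
      unfolding l_coset_def by blast
  qed
qed

lemma lcosets_stab: "lcosets stab = fibre ` \<pi> ` carrier G"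
  by (auto simp: LCOSETS_def l_coset_stab)

text \<open>One label in the image suffices: its fibre is nonempty, and any element of the common
  fibre determines both labels.\<close>

lemma fibre_eq_iff: "l \<in> \<pi> ` carrier G \<Longrightarrow> fibre l = fibre l' \<longleftrightarrow> l = l'"
  by (auto simp: fibre_def)

lemma l_coset_fibre:
  assumes "g \<in> carrier G" "l \<in> \<pi> ` carrier G"
  shows "g <# fibre l = fibre (act g l)"
proof -
  obtain x where x: "x \<in> carrier G" "l = \<pi> x"
    using assms by blast
  then show ?thesis
    using assms subgroup.subset[OF subgroup_stab]
    by (simp add: l_coset_stab[symmetric] lcos_m_assoc equivariant[symmetric])
qed

lemma gset_coset_gset_stab: "gset G (coset_gset G stab)"
  by (rule gset_coset_gset[OF subgroup.subset[OF subgroup_stab]])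

lemma common_fixpoints_coset_gset:
  assumes "g \<in> carrier G" "h \<in> carrier G"
  shows "common_fixpoints (coset_gset G stab) g h =
    fibre ` {l \<in> \<pi> ` carrier G. act g l = l \<and> act h l = l}"
proof -
  have iff: "g <# fibre l = fibre l \<longleftrightarrow> act g l = l" if "g \<in> carrier G" "l \<in> \<pi> ` carrier G" for g l
    unfolding l_coset_fibre[OF that] using fibre_eq_iff[OF that(2), of "act g l"] by metis
  have "common_fixpoints (coset_gset G stab) g h =
      {C \<in> fibre ` \<pi> ` carrier G. g <# C = C \<and> h <# C = C}"
    unfolding common_fixpoints_def coset_gset_def fst_conv snd_conv lcosets_stab
    by (intro Collect_cong conj_cong refl) simp_all
  also have "\<dots> = fibre ` {l \<in> \<pi> ` carrier G. g <# fibre l = fibre l \<and> h <# fibre l = fibre l}"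
    by blast
  also have "{l \<in> \<pi> ` carrier G. g <# fibre l = fibre l \<and> h <# fibre l = fibre l} =
      {l \<in> \<pi> ` carrier G. act g l = l \<and> act h l = l}"
    by (intro Collect_cong conj_cong refl iff assms)
  finally show ?thesis .
qed

lemma card_common_fixpoints_coset_gset:
  assumes "g \<in> carrier G" "h \<in> carrier G"
  shows "card (common_fixpoints (coset_gset G stab) g h) =
    card {l \<in> \<pi> ` carrier G. act g l = l \<and> act h l = l}"
  unfolding common_fixpoints_coset_gset[OF assms]
  by (intro card_image) (auto intro!: inj_onI simp: fibre_eq_iff)

end


section \<open>The symmetric group on three letters\<close>

text \<open>The six elements are written through transpositions so that both their values and their
  parities can be computed by rewriting.\<close>

lemma permutes_3_cases:
  fixes p :: "nat \<Rightarrow> nat"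
  assumes "p permutes {1..3}"
  shows "p \<in> {id, transpose 1 2, transpose 1 3, transpose 2 3,
    transpose 1 2 \<circ> transpose 2 3, transpose 2 3 \<circ> transpose 1 2}"
proof -
  have three: "{1..3::nat} = {1, 2, 3}" by auto
  have in3: "p 1 \<in> {1, 2, 3}" "p 2 \<in> {1, 2, 3}" "p 3 \<in> {1, 2, 3}"
    using permutes_in_image[OF assms] unfolding three by blast+
  have ne: "p 1 \<noteq> p 2" "p 1 \<noteq> p 3" "p 2 \<noteq> p 3"
    using permutes_inj[OF assms] by (auto simp: inj_eq)
  have out: "p x = x" if "x \<noteq> 1" "x \<noteq> 2" "x \<noteq> 3" for x
    using that assms unfolding three by (simp add: permutes_def)
  have eqI: "p = q" if "p 1 = q 1" "p 2 = q 2" "p 3 = q 3" "\<And>x. x \<noteq> 1 \<Longrightarrow> x \<noteq> 2 \<Longrightarrow> x \<noteq> 3 \<Longrightarrow> q x = x" for q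
  proof
    fix x
    show "p x = q x"
      using that out by (cases "x = 1 \<or> x = 2 \<or> x = 3") auto
  qed
  have "p 1 = 1 \<and> p 2 = 2 \<and> p 3 = 3 \<or> p 1 = 2 \<and> p 2 = 1 \<and> p 3 = 3 \<or>
      p 1 = 3 \<and> p 2 = 2 \<and> p 3 = 1 \<or> p 1 = 1 \<and> p 2 = 3 \<and> p 3 = 2 \<or>
      p 1 = 2 \<and> p 2 = 3 \<and> p 3 = 1 \<or> p 1 = 3 \<and> p 2 = 1 \<and> p 3 = 2"
    using in3 ne by (elim insertE emptyE) simp_all
  then consider "p 1 = 1" "p 2 = 2" "p 3 = 3" | "p 1 = 2" "p 2 = 1" "p 3 = 3"
    | "p 1 = 3" "p 2 = 2" "p 3 = 1" | "p 1 = 1" "p 2 = 3" "p 3 = 2"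
    | "p 1 = 2" "p 2 = 3" "p 3 = 1" | "p 1 = 3" "p 2 = 1" "p 3 = 2"
    by blast
  then show ?thesis
  proof cases
    case 1
    then have "p = id" by (intro eqI) auto
    then show ?thesis by simp
  next
    case 2
    then have "p = transpose 1 2" by (intro eqI) (auto simp: transpose_def)
    then show ?thesis by simp
  next
    case 3
    then have "p = transpose 1 3" by (intro eqI) (auto simp: transpose_def)
    then show ?thesis by simp
  next
    case 4
    then have "p = transpose 2 3" by (intro eqI) (auto simp: transpose_def)
    then show ?thesis by simp
  next
    case 5
    then have "p = transpose 1 2 \<circ> transpose 2 3" by (intro eqI) (auto simp: transpose_def)
    then show ?thesis by simp
  next
    case 6
    then have "p = transpose 2 3 \<circ> transpose 1 2" by (intro eqI) (auto simp: transpose_def)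
    then show ?thesis by simp
  qed
qed

lemma evenperm_transpose_comp:
  "a \<noteq> b \<Longrightarrow> c \<noteq> d \<Longrightarrow> evenperm (transpose a b \<circ> transpose c d)"
  by (simp add: evenperm_comp permutation_swap_id evenperm_swap)

lemma Sigma3_simps:
  "carrier Sigma3 = {p. p permutes {1..3}}" "g \<otimes>\<^bsub>Sigma3\<^esub> h = g \<circ> h" "\<one>\<^bsub>Sigma3\<^esub> = id"
  by (auto simp: sym_group_carrier sym_group_mult sym_group_one)

interpretation Sigma3: group Sigma3
  by (rule sym_group_is_group)

text \<open>Labelling a permutation by its image of 3 identifies the cosets of the subgroup fixing
  3, generated by (12), with the letters 1, 2, 3 under the natural action.\<close>

interpretation point_label: equivariant_label Sigma3 "\<lambda>x. x (3::nat)" "\<lambda>g i. g i"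
  by unfold_locales (simp add: Sigma3_simps)

text \<open>Labelling by parity identifies the cosets of the alternating group, generated by (123),
  with the two parities; odd permutations swap them.\<close>

interpretation sign_label: equivariant_label Sigma3 evenperm "\<lambda>g b. evenperm g \<longleftrightarrow> b"
  by unfold_locales (simp add: sym_group_mult evenperm_comp sym_group_carrier')

lemma transposes_in_Sigma3:
  "transpose 1 2 \<in> carrier Sigma3" "transpose 1 3 \<in> carrier Sigma3" "transpose 2 3 \<in> carrier Sigma3"
  by (auto simp: Sigma3_simps intro!: permutes_swap_id)

lemma generate_transposition: "generate Sigma3 {cycle_of_list [1, 2]} = point_label.stab"
proof
  show "generate Sigma3 {cycle_of_list [1, 2]} \<subseteq> point_label.stab"
    using transposes_in_Sigma3
    by (intro Sigma3.generate_subgroup_incl[OF _ point_label.subgroup_stab])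
      (simp add: point_label.stab_def Sigma3_simps transpose_def)
  show "point_label.stab \<subseteq> generate Sigma3 {cycle_of_list [1, 2]}"
  proof
    fix x
    assume "x \<in> point_label.stab"
    then have x: "x permutes {1..3}" "x 3 = 3"
      by (auto simp: point_label.stab_def Sigma3_simps)
    have "x = \<one>\<^bsub>Sigma3\<^esub> \<or> x = cycle_of_list [1, 2]"
      using permutes_3_cases[OF x(1)] x(2) by (auto simp: Sigma3_simps transpose_def)
    then show "x \<in> generate Sigma3 {cycle_of_list [1, 2]}"
      using generate.one[of Sigma3] generate.incl[of _ _ Sigma3] by blast
  qed
qed

lemma generate_3_cycle: "generate Sigma3 {cycle_of_list [1, 2, 3]} = sign_label.stab"
proof
  let ?c = "cycle_of_list [1, 2, 3] :: nat \<Rightarrow> nat"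
  have c: "?c = transpose 1 2 \<circ> transpose 2 3"
    by simp
  have "?c \<in> carrier Sigma3"
    using Sigma3.m_closed[OF transposes_in_Sigma3(1,3)] by (simp add: Sigma3_simps)
  then show "generate Sigma3 {?c} \<subseteq> sign_label.stab"
    by (intro Sigma3.generate_subgroup_incl[OF _ sign_label.subgroup_stab])
      (simp add: sign_label.stab_def Sigma3_simps evenperm_transpose_comp)
  show "sign_label.stab \<subseteq> generate Sigma3 {?c}"
  proof
    fix x
    assume "x \<in> sign_label.stab"
    then have x: "x permutes {1..3}" "evenperm x"
      by (auto simp: sign_label.stab_def Sigma3_simps)
    \<comment> \<open>The square of the 3-cycle is the other 3-cycle, the one remaining even
      permutation.\<close>
    have "?c \<circ> ?c = transpose 2 3 \<circ> transpose 1 2"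
      unfolding c by (auto simp: fun_eq_iff transpose_def)
    then have "x = \<one>\<^bsub>Sigma3\<^esub> \<or> x = ?c \<or> x = ?c \<otimes>\<^bsub>Sigma3\<^esub> ?c"
      using permutes_3_cases[OF x(1)] x(2) unfolding c by (auto simp: Sigma3_simps evenperm_swap)
    moreover have "?c \<in> generate Sigma3 {?c}"
      by (rule generate.incl) simp
    ultimately show "x \<in> generate Sigma3 {?c}"
      using generate.one[of Sigma3] generate.eng[of _ Sigma3] by blast
  qed
qed

lemma image_point_label: "(\<lambda>x. x 3) ` carrier Sigma3 = {1, 2, 3}"
proof
  have "x 3 \<in> {1..3}" if "x permutes {1..3}" for x :: "nat \<Rightarrow> nat"
    using permutes_in_image[OF that, of 3] by simp
  then show "(\<lambda>x. x 3) ` carrier Sigma3 \<subseteq> {1, 2, 3}"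
    by (fastforce simp: Sigma3_simps)
  have "transpose 1 3 (3::nat) = 1" "transpose 2 3 (3::nat) = 2" "id (3::nat) = 3"
    by simp_all
  then show "{1, 2, 3} \<subseteq> (\<lambda>x. x 3) ` carrier Sigma3"
    using transposes_in_Sigma3 Sigma3.one_closed unfolding Sigma3_simps(3)
    by (metis (mono_tags, lifting) empty_subsetI imageI insert_subset)
qed

lemma image_sign_label: "evenperm ` carrier Sigma3 = UNIV"
proof -
  have "evenperm (transpose 1 (2::nat)) = False" "evenperm (id :: nat \<Rightarrow> nat) = True"
    by (simp_all add: evenperm_swap)
  then have "True \<in> evenperm ` carrier Sigma3" "False \<in> evenperm ` carrier Sigma3"
    using transposes_in_Sigma3(1) Sigma3.one_closed unfolding Sigma3_simps(3) by (metis imageI)+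
  then show ?thesis
    unfolding UNIV_bool by blast
qed

section \<open>Counting common fixed points in the two G-sets\<close>

lemma gset_S_gset: "gset Sigma3 S_gset"
  unfolding S_gset_def
  by (intro gset_gset_sum Sigma3.gset_regular_gset Sigma3.gset_point_gset)

lemma gset_S'_gset: "gset Sigma3 S'_gset"
  unfolding S'_gset_def generate_transposition generate_3_cycle
  by (intro gset_gset_sum point_label.gset_coset_gset_stab sign_label.gset_coset_gset_stab)

text \<open>Left multiplication is free, so the regular part contributes its six points only to the
  identity pair; the two one-point sets always contribute 2.\<close>

lemma card_common_fixpoints_S_gset:
  assumes "g \<in> carrier Sigma3" "h \<in> carrier Sigma3"
  shows "card (common_fixpoints S_gset g h) = (if g = id \<and> h = id then 6 else 0) + 2"
proof -
  have pt: "common_fixpoints point_gset g h = {()}"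
    by (auto simp: common_fixpoints_def point_gset_def)
  have "g \<circ> x = x \<longleftrightarrow> g = id" if "x \<in> carrier Sigma3" "g \<in> carrier Sigma3" for g x
    using Sigma3.r_cancel_one[OF that] by (simp add: Sigma3_simps)
  then have "common_fixpoints (regular_gset Sigma3) g h =
      (if g = id \<and> h = id then carrier Sigma3 else {})"
    using assms by (auto simp: common_fixpoints_def regular_gset_def sym_group_mult)
  moreover have "card (carrier Sigma3) = 6" "finite (carrier Sigma3)"
    by (simp_all add: Sigma3_simps(1) card_permutations[OF refl] fact_numeral finite_permutations)
  ultimately show ?thesis
    unfolding S_gset_def common_fixpoints_gset_sum pt by (auto simp: card_Plus)
qed

lemma common_fixpoints_S'_gset:
  "common_fixpoints S'_gset g h =
    common_fixpoints (coset_gset Sigma3 point_label.stab) g h <+>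
    common_fixpoints (coset_gset Sigma3 point_label.stab) g h <+>
    common_fixpoints (coset_gset Sigma3 sign_label.stab) g h"
  unfolding S'_gset_def generate_transposition generate_3_cycle common_fixpoints_gset_sum ..

lemma finite_common_fixpoints_coset_gset:
  assumes "g \<in> carrier Sigma3" "h \<in> carrier Sigma3"
  shows "finite (common_fixpoints (coset_gset Sigma3 point_label.stab) g h)"
    "finite (common_fixpoints (coset_gset Sigma3 sign_label.stab) g h)"
  unfolding point_label.common_fixpoints_coset_gset[OF assms]
    sign_label.common_fixpoints_coset_gset[OF assms] image_point_label by simp_all

text \<open>Each of the two cosets spaces of (12) counts letters fixed by both permutations; the
  space of parities is fixed pointwise by even permutations and has no point fixed by an odd
  one.\<close>

lemma card_common_fixpoints_S'_gset:
  assumes "g \<in> carrier Sigma3" "h \<in> carrier Sigma3"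
  shows "card (common_fixpoints S'_gset g h) =
    2 * card {i \<in> {1, 2, 3}. g i = i \<and> h i = i} + (if evenperm g \<and> evenperm h then 2 else 0)"
proof -
  have "card (common_fixpoints (coset_gset Sigma3 point_label.stab) g h) =
      card {i \<in> {1, 2, 3}. g i = i \<and> h i = i}"
    unfolding point_label.card_common_fixpoints_coset_gset[OF assms] image_point_label ..
  moreover have "card (common_fixpoints (coset_gset Sigma3 sign_label.stab) g h) =
      (if evenperm g \<and> evenperm h then 2 else 0)"
    unfolding sign_label.card_common_fixpoints_coset_gset[OF assms] image_sign_label
    by (auto simp: UNIV_bool)
  ultimately show ?thesis
    using finite_common_fixpoints_coset_gset[OF assms]
    by (simp add: common_fixpoints_S'_gset card_Plus)
qed

text \<open>A finite check over pairs. Commutativity matters: for (12) and (23) the counts are 2 and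
  0.\<close>

lemma card_common_fixpoints_eq:
  assumes "g \<in> carrier Sigma3" "h \<in> carrier Sigma3" "g \<otimes>\<^bsub>Sigma3\<^esub> h = h \<otimes>\<^bsub>Sigma3\<^esub> g"
  shows "card (common_fixpoints S_gset g h) = card (common_fixpoints S'_gset g h)"
proof -
  have card: "card {i \<in> {1, 2, 3 :: nat}. P i} = of_bool (P 1) + of_bool (P 2) + of_bool (P 3)" for P
    by (simp add: Collect_conv_if conj_disj_distribR Collect_disj_eq)
  \<comment> \<open>Two letters suffice, since an element of the group is determined by its values
    on 1 and 2; in the case split these equations refute the noncommuting pairs.\<close>
  have comm: "g (h 1) = h (g 1)" "g (h 2) = h (g 2)"
    using assms(3) by (simp_all add: Sigma3_simps fun_eq_iff)
  have id_iff: "g' = id \<longleftrightarrow> g' 1 = 1 \<and> g' 2 = 2" if "g' \<in> carrier Sigma3" for g'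
    using permutes_3_cases[of g'] that by (auto simp: Sigma3_simps transpose_def)
  have g: "g \<in> {id, transpose 1 2, transpose 1 3, transpose 2 3,
    transpose 1 2 \<circ> transpose 2 3, transpose 2 3 \<circ> transpose 1 2}"
    and h: "h \<in> {id, transpose 1 2, transpose 1 3, transpose 2 3,
    transpose 1 2 \<circ> transpose 2 3, transpose 2 3 \<circ> transpose 1 2}"
    using assms permutes_3_cases unfolding Sigma3_simps by blast+
  have "(if g = id \<and> h = id then 6 else 0) + 2 = 2 * card {i \<in> {1, 2, 3}. g i = i \<and> h i = i} +
      (if evenperm g \<and> evenperm h then 2 else 0)"
    unfolding card id_iff[OF assms(1)] id_iff[OF assms(2)]
    using g h comm
    by (elim insertE emptyE)
      (simp_all add: evenperm_swap evenperm_transpose_comp transpose_def)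
  then show ?thesis
    by (simp add: card_common_fixpoints_S_gset card_common_fixpoints_S'_gset assms)
qed

text \<open>The witnesses (12) and (23) fix no common letter, and both are odd, so they have no
  common fixed point in any of the three coset spaces.\<close>

lemma S'_gset_no_fixed_point:
  assumes "s \<in> fst S'_gset"
  shows "\<exists>g\<in>carrier Sigma3. snd S'_gset g s \<noteq> s"
proof (rule ccontr)
  assume "\<not> ?thesis"
  then have s: "s \<in> common_fixpoints S'_gset g h" if "g \<in> carrier Sigma3" "h \<in> carrier Sigma3" for g h
    using assms that by (auto simp: common_fixpoints_def)
  let ?t = "transpose 1 2 :: nat \<Rightarrow> nat" and ?u = "transpose 2 3 :: nat \<Rightarrow> nat"
  have "card {i \<in> {1, 2, 3}. ?t i = i \<and> ?u i = i} = 0"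
    by (auto simp: transpose_def)
  then have "card (common_fixpoints S'_gset ?t ?u) = 0"
    using transposes_in_Sigma3
    by (subst card_common_fixpoints_S'_gset) (simp_all add: evenperm_swap)
  \<comment> \<open>Infinite sets also have \<open>card\<close> 0, so emptiness requires
    finiteness.\<close>
  moreover have "finite (common_fixpoints S'_gset ?t ?u)"
    using finite_common_fixpoints_coset_gset[OF transposes_in_Sigma3(1,3)]
    by (simp add: common_fixpoints_S'_gset)
  ultimately show False
    using s[OF transposes_in_Sigma3(1,3)] by simp
qed

theorem mainTheorem4:
  fixes xs :: "((nat \<Rightarrow> nat) + unit + unit) list"
    and xs' :: "((nat \<Rightarrow> nat) set + (nat \<Rightarrow> nat) set + (nat \<Rightarrow> nat) set) list"
    and \<rho> \<rho>' :: "(nat \<Rightarrow> nat, unit, complex) rep2"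
  assumes "distinct xs" "set xs = fst S_gset"
    and "distinct xs'" "set xs' = fst S'_gset"
    and "\<rho> = gset_rep2 Sigma3 S_gset xs"
    and "\<rho>' = gset_rep2 Sigma3 S'_gset xs'"
  shows "is_rep2 Sigma3 \<rho> \<and> deg \<rho> = 8 \<and> is_rep2 Sigma3 \<rho>' \<and> deg \<rho>' = 8
    \<and> \<not> equivalent2 TYPE('u) Sigma3 \<rho> \<rho>'
    \<and> (\<forall>g\<in>carrier Sigma3. \<forall>h\<in>carrier Sigma3. g \<otimes>\<^bsub>Sigma3\<^esub> h = h \<otimes>\<^bsub>Sigma3\<^esub> g \<longrightarrow>
        character2 Sigma3 \<rho> g h = character2 Sigma3 \<rho>' g h)
    \<and> \<not> (\<forall>(R :: (nat \<Rightarrow> nat, unit, complex) rep2) (R' :: (nat \<Rightarrow> nat, unit, complex) rep2).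
        is_rep2 Sigma3 R \<and> is_rep2 Sigma3 R' \<and> same_character2 Sigma3 R R' \<longrightarrow>
        equivalent2 TYPE('u) Sigma3 R R')"
proof -
  interpret X: ordered_gset Sigma3 S_gset xs
    by (intro ordered_gset.intro gset_S_gset ordered_gset_axioms.intro assms)
  interpret Y: ordered_gset Sigma3 S'_gset xs'
    by (intro ordered_gset.intro gset_S'_gset ordered_gset_axioms.intro assms)
  have rep: "is_rep2 Sigma3 \<rho>" "is_rep2 Sigma3 \<rho>'"
    unfolding assms(5,6) by (rule X.is_rep2_gset_rep2 Y.is_rep2_gset_rep2)+
  have id: "id \<in> carrier Sigma3"
    using Sigma3.one_closed by (simp add: Sigma3_simps)
  \<comment> \<open>The dimensions come from the same counts: every point is fixed by the identity
    pair, whose count is 6 + 2.\<close>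
  have fixed_by_id: "common_fixpoints S_gset id id = set xs" "common_fixpoints S'_gset id id = set xs'"
    using X.act_one Y.act_one assms(2,4) by (auto simp: common_fixpoints_def Sigma3_simps(3))
  have "card (set xs) = 8"
    using card_common_fixpoints_S_gset[OF id id] by (simp add: fixed_by_id)
  moreover have "card (set xs') = 8"
    using card_common_fixpoints_eq[OF id id] calculation by (simp add: fixed_by_id)
  ultimately have deg: "deg \<rho> = 8" "deg \<rho>' = 8"
    unfolding assms(5,6) X.deg_gset_rep2 Y.deg_gset_rep2 using assms(1,3) by (simp_all add: distinct_card)
  have char: "\<forall>g\<in>carrier Sigma3. \<forall>h\<in>carrier Sigma3. g \<otimes>\<^bsub>Sigma3\<^esub> h = h \<otimes>\<^bsub>Sigma3\<^esub> g \<longrightarrow>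
      character2 Sigma3 \<rho> g h = character2 Sigma3 \<rho>' g h"
    unfolding assms(5,6)
    by (simp add: X.character2_gset_rep2 Y.character2_gset_rep2 card_common_fixpoints_eq)
  \<comment> \<open>One of the two adjoined one-point orbits is the fixed point that an equivalence
    would transport to the other G-set.\<close>
  have "Inr (Inl ()) \<in> fst S_gset" "snd S_gset g (Inr (Inl ())) = Inr (Inl ())" for g
    by (auto simp: S_gset_def gset_sum_def point_gset_def)
  then have inequiv: "\<not> equivalent2 TYPE('u) Sigma3 \<rho> \<rho>'"
    using equivalent2_gset_rep2_fixed_point[OF X.ordered_gset_axioms Y.ordered_gset_axioms]
      S'_gset_no_fixed_point unfolding assms(5,6) by metis
  show ?thesis
    using rep deg char inequiv unfolding same_character2_def by blast
qed

end
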